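(* Let $K$ be a field. For a given finite order ideal $\mathcal O$ of terms in $K[x_1,\dots,x_n]$, the border marked scheme $\mathrm{Spec}(K[C]/\mathfrak B)$ of $\mathcal O$ and the Pommaret marked scheme $\mathrm{Spec}(K[C\setminus\tilde C]/\mathfrak P)$ of $\mathcal O$ are isomorphic.
   Context: $\mathbb T$ is the set of terms (monic monomials) in the variables $x_1<\dots<x_n$. For a term $\tau\ne1$, $\min(\tau)$ is the smallest variable dividing $\tau$. An order ideal is a (nonempty) set of terms closed under taking divisors. For a finite order ideal $\mathcal O=\{\sigma_1,\dots,\sigma_\ell\}$, the border is $\partial\mathcal O=\{x_i\tau:\tau\in\mathcal O,\ 1\le i\le n\}\setminus\mathcal O$. Write $\partial\mathcal O=\{\tau_1,\dots,\tau_m\}$, ordered increasingly by degree (terms of equal degree arbitrarily). The Pommaret basis $\mathcal P_{\mathcal O}\subseteq\partial\mathcal O$ is the set of terms $\sigma$ in the ideal $J$ generated by $\mathbb T\setminus\mathcal O$ with $\sigma/\min(\sigma)\notin J$. Generic marked sets: let $C=\{C_{ij}:1\le i\le m,\ 1\le j\le\ell\}$ be new parameters and $b_i=\tau_i-\sum_{j=1}^\ell C_{ij}\sigma_j\in K[C][x_1,\dots,x_n]$, with head term $\mathrm{Ht}(b_i)=\tau_i$. Put $\mathscr B=\{b_1,\dots,b_m\}$ (generic $\partial\mathcal O$-marked set), $\mathscr P=\{b_i:\tau_i\in\mathcal P_{\mathcal O}\}$ (generic $\mathcal P_{\mathcal O}$-marked set), and $\tilde C=\{C_{ij}:\tau_i\in\partial\mathcal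 O\setminus\mathcal P_{\mathcal O}\}$. Multiplicative sets: for the border structure, $\mathcal T_{\tau_i}=\{\mu\in\mathbb T:\tau_j\text{ does not divide }\tau_i\mu\text{ for all }j>i\}$ for $\tau_i\in\partial\mathcal O$; for the Pommaret structure, $\mathcal T_\alpha=\mathbb T\cap K[x_1,\dots,\min(\alpha)]$ for $\alpha\in\mathcal P_{\mathcal O}$. The cone of $\alpha$ is $\{\eta\alpha:\eta\in\mathcal T_\alpha\}$. In each structure, a reduction step replaces a polynomial $g$ by $g-c\,\eta\, b$, where $b$ is in the marked set, $\eta\in\mathcal T_{\mathrm{Ht}(b)}$, and $\eta\,\mathrm{Ht}(b)$ is in the support of $g$ with coefficient $c$. Both reduction relations (finitely many, possibly zero, steps) are Noetherian and confluent, so every polynomial reduces to a unique polynomial supported on $\mathcal O$ (an $\mathcal O$-reduced polynomial). $S(f,f')=\eta f-\eta'f'$, where $\eta\,\mathrm{Ht}(f)=\eta'\,\mathrm{Ht}(f')=\mathrm{lcm}(\mathrm{Ht}(f),\mathrm{Ht}(f'))$. Border marked scheme: a couple $(\alpha,\alpha')$ of border terms is a neighbour couple if $\alpha=x_j\alpha'$ for some $j$ or $x_i\alpha=x_j\alpha'$ for some $i,j$. For each $b_r,b_s\in\mathscr B$ whose head terms form a neighbour couple, let $h_{rs}$ be the $\mathcal O$-reduced polynomial to which $S(b_r,b_s)$ reduces by $\mathscr B$ in the border structure. $\mathfrak B\subset K[C]$ is the ideal generated by all coefficients (with respect to the terms in $x_1,\dots,x_n$) of the $h_{rs}$. The border marked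 scheme is $\mathrm{Spec}(K[C]/\mathfrak B)$. Pommaret marked scheme: a couple $(\alpha,\alpha')$ in $\mathcal P_{\mathcal O}$ is non-multiplicative if there is a variable $x_i\notin\mathcal T_\alpha$ with $x_i\alpha$ in the cone of $\alpha'$ (Pommaret structure). For each $p_r,p_s\in\mathscr P$ whose head terms form a non-multiplicative couple, let $h'_{rs}$ be the $\mathcal O$-reduced polynomial to which $S(p_r,p_s)$ reduces by $\mathscr P$ in the Pommaret structure. $\mathfrak P\subset K[C\setminus\tilde C]$ is the ideal generated by all coefficients (with respect to the terms in $x_1,\dots,x_n$) of the $h'_{rs}$. The Pommaret marked scheme is $\mathrm{Spec}(K[C\setminus\tilde C]/\mathfrak P)$. *)

theory Defs
  imports
    "HOL-Library.Poly_Mapping"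
    "HOL-Algebra.QuotRing"
    "HOL-Analysis.Abstract_Topology"
begin

section \<open>Affine schemes over a field\<close>

text \<open>Prime spectrum with the Zariski topology: the closed sets are the sets
  \<open>V(S)\<close> of primes containing a given set \<open>S\<close> of ring elements.\<close>

definition spec_points :: "('a, 'm) ring_scheme \<Rightarrow> 'a set set" where
  "spec_points R = {p. primeideal p R}"

definition zariski_open :: "('a, 'm) ring_scheme \<Rightarrow> 'a set set \<Rightarrow> bool" where
  "zariski_open R U \<longleftrightarrow>
     (\<exists>S \<subseteq> carrier R. U = spec_points R - {p \<in> spec_points R. S \<subseteq> p})"

lemma istopology_zariski_open: "istopology (zariski_open R)"
  unfolding istopology_def
proof (intro conjI allI impI)
  fix U V assume "zariski_open R U" "zariski_open R V"
  then obtain S T where S: "S \<subseteq> carrier R" "U = spec_points R - {p \<in> spec_points R. S \<subseteq> p}"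
    and T: "T \<subseteq> carrier R" "V = spec_points R - {p \<in> spec_points R. T \<subseteq> p}"
    unfolding zariski_open_def by (elim exE conjE)
  define W where "W = (\<lambda>(s, t). s \<otimes>\<^bsub>R\<^esub> t) ` (S \<times> T) \<inter> carrier R"
  have W: "W \<subseteq> p \<longleftrightarrow> S \<subseteq> p \<or> T \<subseteq> p" if "p \<in> spec_points R" for p
  proof -
    interpret primeideal p R using that by (simp add: spec_points_def)
    have "s \<in> p \<or> t \<in> p" if "W \<subseteq> p" "s \<in> S" "t \<in> T" for s t
    proof -
      have st: "s \<in> carrier R" "t \<in> carrier R" using that S(1) T(1) by auto
      then have "s \<otimes>\<^bsub>R\<^esub> t \<in> W" using that by (auto simp: W_def)
      then show ?thesis using I_prime[OF st] that(1) by auto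
    qed
    moreover have "W \<subseteq> p" if "S \<subseteq> p"
      using that T(1) by (auto simp: W_def intro!: I_r_closed)
    moreover have "W \<subseteq> p" if "T \<subseteq> p"
      using that S(1) by (auto simp: W_def intro!: I_l_closed)
    ultimately show ?thesis by auto
  qed
  have "U \<inter> V = spec_points R - {p \<in> spec_points R. W \<subseteq> p}"
    unfolding S(2) T(2) using W by auto
  then show "zariski_open R (U \<inter> V)"
    unfolding zariski_open_def by (intro exI[of _ W]) (simp add: W_def)
next
  fix \<K> assume "\<forall>K\<in>\<K>. zariski_open R K"
  then obtain S where S: "\<forall>K\<in>\<K>. S K \<subseteq> carrier R \<and>
      K = spec_points R - {p \<in> spec_points R. S K \<subseteq> p}"
    unfolding zariski_open_def by (auto simp: Bex_def dest!: bchoice)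
  have sub: "(\<Union>K\<in>\<K>. S K) \<subseteq> carrier R"
    using S by auto
  have mem: "p \<in> \<Union>\<K> \<longleftrightarrow> p \<in> spec_points R \<and> \<not> (\<Union>K\<in>\<K>. S K) \<subseteq> p"
    for p
  proof -
    have "p \<in> K \<longleftrightarrow> p \<in> spec_points R \<and> \<not> S K \<subseteq> p" if "K \<in> \<K>" for K
      using S that by (subst bspec[OF S that, THEN conjunct2]) auto
    then show ?thesis by (auto simp: UN_subset_iff)
  qed
  have "\<Union>\<K> = spec_points R - {p \<in> spec_points R. (\<Union>K\<in>\<K>. S K) \<subseteq> p}"
    by (rule Set.set_eqI, subst mem) auto
  with sub show "zariski_open R (\<Union>\<K>)"
    unfolding zariski_open_def by (intro exI[of _ "\<Union>K\<in>\<K>. S K"] conjI)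
qed

definition zariski_topology :: "('a, 'm) ring_scheme \<Rightarrow> 'a set topology" where
  "zariski_topology R = topology (zariski_open R)"

text \<open>Localization at a prime \<open>p\<close>. The fraction \<open>a/f\<close> is the class of all pairs \<open>(b, g)\<close>
  with \<open>h (g a - f b) = 0\<close> for some \<open>h \<notin> p\<close>; the unions below are over the representatives
  of the two arguments, and all the united classes coincide.\<close>

definition loc_frac :: "('a, 'm) ring_scheme \<Rightarrow> 'a set \<Rightarrow> 'a \<Rightarrow> 'a \<Rightarrow> ('a \<times> 'a) set" where
  "loc_frac R p a f = {(b, g). b \<in> carrier R \<and> g \<in> carrier R - p \<and>
     (\<exists>h \<in> carrier R - p. h \<otimes>\<^bsub>R\<^esub> (g \<otimes>\<^bsub>R\<^esub> a) = h \<otimes>\<^bsub>R\<^esub> (f \<otimes>\<^bsub>R\<^esub> b))}"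

definition localization :: "('a, 'm) ring_scheme \<Rightarrow> 'a set \<Rightarrow> ('a \<times> 'a) set ring" where
  "localization R p =
    \<lparr>carrier = {loc_frac R p a f | a f. a \<in> carrier R \<and> f \<in> carrier R - p},
     mult = (\<lambda>x y. \<Union>(a, f)\<in>x. \<Union>(b, g)\<in>y. loc_frac R p (a \<otimes>\<^bsub>R\<^esub> b) (f \<otimes>\<^bsub>R\<^esub> g)),
     one = loc_frac R p \<one>\<^bsub>R\<^esub> \<one>\<^bsub>R\<^esub>,
     zero = loc_frac R p \<zero>\<^bsub>R\<^esub> \<one>\<^bsub>R\<^esub>,
     add = (\<lambda>x y. \<Union>(a, f)\<in>x. \<Union>(b, g)\<in>y.
              loc_frac R p (g \<otimes>\<^bsub>R\<^esub> a \<oplus>\<^bsub>R\<^esub> f \<otimes>\<^bsub>R\<^esub> b) (f \<otimes>\<^bsub>R\<^esub> g))\<rparr>"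

text \<open>Structure sheaf: sections over \<open>U\<close> are families of elements of the localizations at the
  points of \<open>U\<close> that are locally given by a single fraction. They are made extensional
  (\<open>undefined\<close> outside \<open>U\<close>).\<close>

definition structure_sections ::
    "('a, 'm) ring_scheme \<Rightarrow> 'a set set \<Rightarrow> ('a set \<Rightarrow> ('a \<times> 'a) set) ring" where
  "structure_sections R U =
    \<lparr>carrier = {s \<in> (\<Pi>\<^sub>E p\<in>U. carrier (localization R p)).
        \<forall>p\<in>U. \<exists>V a f. openin (zariski_topology R) V \<and> p \<in> V \<and> V \<subseteq> U \<and>
          a \<in> carrier R \<and> f \<in> carrier R \<and> (\<forall>q\<in>V. f \<notin> q \<and> s q = loc_frac R q a f)},
     mult = (\<lambda>s t. \<lambda>p\<in>U. s p \<otimes>\<^bsub>localization R p\<^esub> t p),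
     one = (\<lambda>p\<in>U. \<one>\<^bsub>localization R p\<^esub>),
     zero = (\<lambda>p\<in>U. \<zero>\<^bsub>localization R p\<^esub>),
     add = (\<lambda>s t. \<lambda>p\<in>U. s p \<oplus>\<^bsub>localization R p\<^esub> t p)\<rparr>"

text \<open>A ringed space together with a map from \<open>K\<close> to its global sections; for a scheme this
  map is the same thing as a structure morphism to \<open>Spec K\<close>.\<close>

record ('p, 's, 'k) ringed_space_over =
  space_of :: "'p topology"
  sections_of :: "'p set \<Rightarrow> 's ring"
  restriction_of :: "'p set \<Rightarrow> 'p set \<Rightarrow> 's \<Rightarrow> 's"
  scalar_of :: "'k \<Rightarrow> 's"

text \<open>\<open>Spec R\<close>, where \<open>R\<close> is regarded as a \<open>K\<close>-algebra through \<open>\<iota>\<close>.\<close>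

definition Spec :: "('a, 'm) ring_scheme \<Rightarrow> ('k \<Rightarrow> 'a)
    \<Rightarrow> ('a set, 'a set \<Rightarrow> ('a \<times> 'a) set, 'k) ringed_space_over" where
  "Spec R \<iota> =
    \<lparr>space_of = zariski_topology R,
     sections_of = structure_sections R,
     restriction_of = (\<lambda>U V s. restrict s V),
     scalar_of = (\<lambda>c. \<lambda>p\<in>spec_points R. loc_frac R p (\<iota> c) \<one>\<^bsub>R\<^esub>)\<rparr>"

text \<open>Isomorphism of ringed spaces over \<open>K\<close>: a homeomorphism \<open>\<phi>\<close> from \<open>X\<close> to \<open>Y\<close> and an
  isomorphism \<open>\<Phi>\<close> from the sheaf of \<open>Y\<close> to the direct image of the sheaf of \<open>X\<close>. The induced
  maps on stalks are isomorphisms, so for locally ringed spaces the condition that they be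
  local is automatic.\<close>

definition isomorphic_over ::
    "('p, 's, 'k) ringed_space_over \<Rightarrow> ('q, 't, 'k) ringed_space_over \<Rightarrow> bool" where
  "isomorphic_over X Y \<longleftrightarrow>
    (\<exists>\<phi> \<Phi>. let pre = (\<lambda>U. {p \<in> topspace (space_of X). \<phi> p \<in> U}) in
       homeomorphic_map (space_of X) (space_of Y) \<phi> \<and>
       (\<forall>U. openin (space_of Y) U \<longrightarrow>
          \<Phi> U \<in> ring_iso (sections_of Y U) (sections_of X (pre U))) \<and>
       (\<forall>U V. openin (space_of Y) U \<longrightarrow> openin (space_of Y) V \<longrightarrow> V \<subseteq> U \<longrightarrow>
          (\<forall>s \<in> carrier (sections_of Y U).
             \<Phi> V (restriction_of Y U V s) = restriction_of X (pre U) (pre V) (\<Phi> U s))) \<and>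
       (\<forall>c. \<Phi> (topspace (space_of Y)) (scalar_of Y c) = scalar_of X c))"


section \<open>Terms\<close>

text \<open>The variables \<open>x\<^sub>1 < \<dots> < x\<^sub>n\<close> are the elements of a finite linearly ordered type \<open>'x\<close>.
  A term is its exponent vector, so multiplication of terms is written \<open>+\<close>, and \<open>1\<close> is \<open>0\<close>.
  The order \<open>\<le>\<close> that the library puts on exponent vectors is not divisibility and is not used.\<close>

type_synonym 'x pterm = "'x \<Rightarrow>\<^sub>0 nat"

definition tvar :: "'x \<Rightarrow> 'x pterm" where
  "tvar x = Poly_Mapping.single x 1"

definition tdvd :: "'x pterm \<Rightarrow> 'x pterm \<Rightarrow> bool" where
  "tdvd s t \<longleftrightarrow> (\<exists>u. t = s + u)"

definition tdeg :: "'x::finite pterm \<Rightarrow> nat" where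
  "tdeg t = (\<Sum>x\<in>UNIV. Poly_Mapping.lookup t x)"

text \<open>Subtraction of exponents is truncated, so this is the pointwise maximum.\<close>

definition tlcm :: "'x pterm \<Rightarrow> 'x pterm \<Rightarrow> 'x pterm" where
  "tlcm s t = s + (t - s)"

definition tmin :: "'x::linorder pterm \<Rightarrow> 'x" where
  "tmin t = Min (Poly_Mapping.keys t)"

definition order_ideal :: "'x pterm set \<Rightarrow> bool" where
  "order_ideal \<O> \<longleftrightarrow> \<O> \<noteq> {} \<and> (\<forall>t\<in>\<O>. \<forall>s. tdvd s t \<longrightarrow> s \<in> \<O>)"

definition border :: "'x pterm set \<Rightarrow> 'x pterm set" where
  "border \<O> = {tvar x + t | x t. t \<in> \<O>} - \<O>"

text \<open>The terms in the monomial ideal generated by a set \<open>G\<close> of terms.\<close>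

definition monomial_ideal_terms :: "'x pterm set \<Rightarrow> 'x pterm set" where
  "monomial_ideal_terms G = {t. \<exists>s\<in>G. tdvd s t}"

definition pommaret_basis :: "'x::linorder pterm set \<Rightarrow> 'x pterm set" where
  "pommaret_basis \<O> = {\<sigma> \<in> monomial_ideal_terms (- \<O>).
     \<sigma> - tvar (tmin \<sigma>) \<notin> monomial_ideal_terms (- \<O>)}"

definition border_enumeration :: "'x::finite pterm set \<Rightarrow> 'x pterm list \<Rightarrow> bool" where
  "border_enumeration \<O> \<tau>s \<longleftrightarrow>
     distinct \<tau>s \<and> set \<tau>s = border \<O> \<and> sorted (map tdeg \<tau>s)"


section \<open>Generic marked sets and reduction\<close>

text \<open>The parameter \<open>C\<^sub>i\<^sub>j\<close> is indexed by the pair of terms \<open>(\<tau>\<^sub>i, \<sigma>\<^sub>j)\<close>. Polynomials in the \<open>x\<close>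
  have coefficients in the type of polynomials in all such parameters; the rings \<open>K[C]\<close> and
  \<open>K[C - C~]\<close> are the subrings given by \<open>param_ring\<close>.\<close>

type_synonym ('x, 'k) param_poly = "('x pterm \<times> 'x pterm \<Rightarrow>\<^sub>0 nat) \<Rightarrow>\<^sub>0 'k"
type_synonym ('x, 'k) xpoly = "'x pterm \<Rightarrow>\<^sub>0 ('x, 'k) param_poly"

definition param_ring :: "'v set \<Rightarrow> (('v \<Rightarrow>\<^sub>0 nat) \<Rightarrow>\<^sub>0 'k::comm_ring_1) ring" where
  "param_ring V =
    \<lparr>carrier = {f. \<forall>m \<in> Poly_Mapping.keys f. Poly_Mapping.keys m \<subseteq> V},
     mult = (*), one = 1, zero = 0, add = (+)\<rparr>"

definition param :: "'x pterm \<Rightarrow> 'x pterm \<Rightarrow> ('x, 'k::comm_ring_1) param_poly" where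
  "param \<tau> \<sigma> = Poly_Mapping.single (Poly_Mapping.single (\<tau>, \<sigma>) 1) 1"

definition marked_poly :: "'x pterm set \<Rightarrow> 'x pterm \<Rightarrow> ('x, 'k::comm_ring_1) xpoly" where
  "marked_poly \<O> \<tau> =
     Poly_Mapping.single \<tau> 1 - (\<Sum>\<sigma>\<in>\<O>. Poly_Mapping.single \<sigma> (param \<tau> \<sigma>))"

definition border_mult :: "'x pterm list \<Rightarrow> 'x pterm \<Rightarrow> 'x pterm set" where
  "border_mult \<tau>s \<alpha> =
     {\<mu>. \<forall>i j. i < j \<longrightarrow> j < length \<tau>s \<longrightarrow> \<tau>s ! i = \<alpha> \<longrightarrow> \<not> tdvd (\<tau>s ! j) (\<alpha> + \<mu>)}"

definition pommaret_mult :: "'x::linorder pterm \<Rightarrow> 'x pterm set" where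
  "pommaret_mult \<alpha> = {\<mu>. \<forall>x \<in> Poly_Mapping.keys \<mu>. x \<le> tmin \<alpha>}"

text \<open>\<open>H\<close> is the set of head terms and \<open>T\<close> the assignment of multiplicative sets.\<close>

definition reduction_step :: "'x pterm set \<Rightarrow> 'x pterm set \<Rightarrow> ('x pterm \<Rightarrow> 'x pterm set)
    \<Rightarrow> ('x, 'k::comm_ring_1) xpoly \<Rightarrow> ('x, 'k) xpoly \<Rightarrow> bool" where
  "reduction_step \<O> H T g g' \<longleftrightarrow>
     (\<exists>\<alpha>\<in>H. \<exists>\<eta>\<in>T \<alpha>. \<eta> + \<alpha> \<in> Poly_Mapping.keys g \<and>
        g' = g - Poly_Mapping.single \<eta> (Poly_Mapping.lookup g (\<eta> + \<alpha>)) * marked_poly \<O> \<alpha>)"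

definition reduced_form :: "'x pterm set \<Rightarrow> 'x pterm set \<Rightarrow> ('x pterm \<Rightarrow> 'x pterm set)
    \<Rightarrow> ('x, 'k::comm_ring_1) xpoly \<Rightarrow> ('x, 'k) xpoly" where
  "reduced_form \<O> H T g =
     (THE h. (reduction_step \<O> H T)\<^sup>*\<^sup>* g h \<and> Poly_Mapping.keys h \<subseteq> \<O>)"

definition s_poly :: "'x pterm set \<Rightarrow> 'x pterm \<Rightarrow> 'x pterm \<Rightarrow> ('x, 'k::comm_ring_1) xpoly" where
  "s_poly \<O> \<alpha> \<alpha>' =
     Poly_Mapping.single (tlcm \<alpha> \<alpha>' - \<alpha>) 1 * marked_poly \<O> \<alpha>
     - Poly_Mapping.single (tlcm \<alpha> \<alpha>' - \<alpha>') 1 * marked_poly \<O> \<alpha>'"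


section \<open>The two marked schemes\<close>

definition neighbour_couple :: "'x pterm \<Rightarrow> 'x pterm \<Rightarrow> bool" where
  "neighbour_couple \<alpha> \<alpha>' \<longleftrightarrow>
     (\<exists>j. \<alpha> = tvar j + \<alpha>') \<or> (\<exists>i j. tvar i + \<alpha> = tvar j + \<alpha>')"

definition nonmultiplicative_couple :: "'x::linorder pterm \<Rightarrow> 'x pterm \<Rightarrow> bool" where
  "nonmultiplicative_couple \<alpha> \<alpha>' \<longleftrightarrow>
     (\<exists>i. tvar i \<notin> pommaret_mult \<alpha> \<and> (\<exists>\<eta>\<in>pommaret_mult \<alpha>'. tvar i + \<alpha> = \<eta> + \<alpha>'))"

definition border_ring :: "'x pterm set \<Rightarrow> ('x, 'k::comm_ring_1) param_poly ring" where
  "border_ring \<O> = param_ring (border \<O> \<times> \<O>)"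

definition pommaret_ring :: "'x::linorder pterm set \<Rightarrow> ('x, 'k::comm_ring_1) param_poly ring" where
  "pommaret_ring \<O> = param_ring (border \<O> \<times> \<O> - (border \<O> - pommaret_basis \<O>) \<times> \<O>)"

definition border_scheme_ideal ::
    "'x pterm set \<Rightarrow> 'x pterm list \<Rightarrow> ('x, 'k::comm_ring_1) param_poly set" where
  "border_scheme_ideal \<O> \<tau>s = Idl\<^bsub>border_ring \<O>\<^esub>
     {Poly_Mapping.lookup (reduced_form \<O> (border \<O>) (border_mult \<tau>s) (s_poly \<O> \<alpha> \<alpha>')) t
       | \<alpha> \<alpha>' t. \<alpha> \<in> border \<O> \<and> \<alpha>' \<in> border \<O> \<and> neighbour_couple \<alpha> \<alpha>'}"

definition pommaret_scheme_ideal ::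
    "'x::linorder pterm set \<Rightarrow> ('x, 'k::comm_ring_1) param_poly set" where
  "pommaret_scheme_ideal \<O> = Idl\<^bsub>pommaret_ring \<O>\<^esub>
     {Poly_Mapping.lookup (reduced_form \<O> (pommaret_basis \<O>) pommaret_mult (s_poly \<O> \<alpha> \<alpha>')) t
       | \<alpha> \<alpha>' t. \<alpha> \<in> pommaret_basis \<O> \<and> \<alpha>' \<in> pommaret_basis \<O> \<and>
          nonmultiplicative_couple \<alpha> \<alpha>'}"

text \<open>\<open>Spec (R/I)\<close> for an ideal \<open>I\<close> of a ring \<open>R\<close> of polynomials in the parameters; \<open>K\<close> acts
  through the residue classes of constant polynomials.\<close>

type_synonym ('x, 'k) marked_scheme =
  "(('x, 'k) param_poly set set,
    ('x, 'k) param_poly set set \<Rightarrow> (('x, 'k) param_poly set \<times> ('x, 'k) param_poly set) set,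
    'k) ringed_space_over"

definition Spec_quotient :: "('x, 'k::comm_ring_1) param_poly ring \<Rightarrow> ('x, 'k) param_poly set
    \<Rightarrow> ('x, 'k) marked_scheme" where
  "Spec_quotient R I = Spec (R Quot I) (\<lambda>c. I +>\<^bsub>R\<^esub> Poly_Mapping.single 0 c)"

definition border_marked_scheme ::
    "'x pterm set \<Rightarrow> 'x pterm list \<Rightarrow> ('x, 'k::comm_ring_1) marked_scheme" where
  "border_marked_scheme \<O> \<tau>s = Spec_quotient (border_ring \<O>) (border_scheme_ideal \<O> \<tau>s)"

definition pommaret_marked_scheme ::
    "'x::linorder pterm set \<Rightarrow> ('x, 'k::comm_ring_1) marked_scheme" where
  "pommaret_marked_scheme \<O> = Spec_quotient (pommaret_ring \<O>) (pommaret_scheme_ideal \<O>)"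

end

theory Submission
  imports Defs
begin

text \<open>
  Let \<open>N t\<close> be the vector of coordinates, with respect to \<open>\<O>\<close>, of the Pommaret normal form of a
  term \<open>t\<close>. Its entries are polynomials in the parameters attached to the Pommaret basis.
  Substituting \<open>N \<tau> \<sigma>\<close> for the parameter attached to \<open>(\<tau>, \<sigma>)\<close>, for all border terms \<open>\<tau>\<close>, is a
  \<open>K\<close>-algebra map from the border parameter ring to the Pommaret parameter ring, and it is the
  identity on the latter. The claim is that this substitution and the inclusion of the two rings
  are mutually inverse modulo the ideals of the two schemes. This rests on one fact about each
  ideal.

  Modulo the Pommaret ideal, normal forms are compatible with multiplication: the normal form of
  \<open>\<epsilon> t\<close> may be computed by first replacing \<open>t\<close> by its normal form (\<open>normal_form_multiple\<close>). The
  tails of the two summands of an S-polynomial are what remains when one and the same term, the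
  least common multiple, is rewritten in two ways. So the substitution turns every reduced
  S-polynomial of border terms into a difference of two expressions for the normal form of that
  term, and the border ideal is mapped into the Pommaret ideal (\<open>substitute_reduced_s_poly\<close>).

  Modulo the border ideal, the formal multiplication operators of the variables on the free
  module over \<open>\<O>\<close> commute; for this the neighbour couples suffice (\<open>neighbours_commute\<close>). Hence
  applying to the basis vector \<open>1\<close> the operators of the variables of \<open>t\<close> gives coordinates of \<open>t\<close>
  that do not depend on the order of the operators. The multiples of all
  marked polynomials have zero coordinates in this sense, so the normal form of \<open>t\<close> with respect to any system of cones with heads
  in the border is congruent to them (\<open>normal_form_power_coord\<close>). For the Pommaret cones this gives
  both that the Pommaret ideal lies in the border ideal (\<open>reduced_s_poly_vanishes\<close>) and that the
  substitution changes each parameter only by an element of the border ideal.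

  Thus the inclusion induces an isomorphism of the quotient rings, and an isomorphism of rings is
  transported to the spectra with their structure sheaves (\<open>Spec_isomorphic_over\<close>).

  The border and the Pommaret structure are treated alike. In both, a term outside \<open>\<O>\<close> is
  uniquely a head term times a multiplicative factor, and rewriting the head term strictly lowers
  a weight of that factor. The weight is the degree for the border; for the Pommaret basis it is a
  positional weight that imitates the lexicographic order.
\<close>

section \<open>Spectra of isomorphic rings\<close>

lemma spec_points_sub: "p \<in> spec_points R \<Longrightarrow> p \<subseteq> carrier R"
  by (simp add: spec_points_def primeideal.axioms(1) ideal.axioms(1) additive_subgroup.a_subset)

lemma openin_zariski: "openin (zariski_topology R) = zariski_open R"
  by (simp add: zariski_topology_def istopology_zariski_open topology_inverse')

lemma zariski_open_sub: "zariski_open R U \<Longrightarrow> U \<subseteq> spec_points R"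
  by (auto simp: zariski_open_def)

lemma zariski_open_UNIV: "zariski_open R (spec_points R)" if "cring R" for R
proof -
  interpret R: cring R by fact
  have "carrier R \<noteq> p" if "p \<in> spec_points R" for p
    using that primeideal.I_notcarr by (auto simp: spec_points_def)
  moreover note spec_points_sub[of _ R]
  ultimately have "spec_points R = spec_points R - {p \<in> spec_points R. carrier R \<subseteq> p}"
    by blast
  then show ?thesis unfolding zariski_open_def by blast
qed

lemma topspace_zariski: "topspace (zariski_topology R) = spec_points R" if "cring R" for R
  using zariski_open_UNIV[OF that] zariski_open_sub
  unfolding topspace_def openin_zariski by blast

text \<open>A ring isomorphism \<open>k\<close> acts on spectra in the opposite direction, by taking preimages of primes,
  while fractions and sections are carried forward by applying \<open>k\<close> to numerators and denominators.\<close>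

locale affine_iso = A: cring A + B: cring B
  for A :: "'a ring" and B :: "'b ring" +
  fixes k :: "'a \<Rightarrow> 'b"
  assumes iso: "k \<in> ring_iso A B"
begin

definition pull :: "'b set \<Rightarrow> 'a set" where
  "pull p = {a \<in> carrier A. k a \<in> p}"

definition push_frac :: "('a \<times> 'a) set \<Rightarrow> ('b \<times> 'b) set" where
  "push_frac x = map_prod k k ` x"

sublocale hom: ring_hom_cring A B k
  using iso by unfold_locales (auto simp: ring_iso_def)

lemma bijective: "bij_betw k (carrier A) (carrier B)"
  using iso by (simp add: ring_iso_def)

lemma inj: "inj_on k (carrier A)" and surj: "k ` carrier A = carrier B"
  using bijective by (auto simp: bij_betw_def)

lemma lift:
  assumes "b \<in> carrier B" obtains a where "a \<in> carrier A" "b = k a"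
  using assms surj by auto

lemma k_eq_iff: "a \<in> carrier A \<Longrightarrow> b \<in> carrier A \<Longrightarrow> k a = k b \<longleftrightarrow> a = b"
  using inj by (auto simp: inj_on_def)

lemma image_pull: "p \<subseteq> carrier B \<Longrightarrow> k ` pull p = p"
proof -
  assume "p \<subseteq> carrier B"
  then have "p \<subseteq> k ` carrier A" by (simp add: surj)
  then show ?thesis by (auto simp: pull_def)
qed

lemma pull_image: "q \<subseteq> carrier A \<Longrightarrow> pull (k ` q) = q"
  by (auto simp: pull_def dest: k_eq_iff[THEN iffD1, rotated 2])

lemma primeideal_pull:
  assumes "primeideal p B"
  shows "primeideal (pull p) A"
proof -
  interpret p: primeideal p B by fact
  have "ideal {r \<in> carrier A. k r \<in> p} A"
    by (rule hom.ring.ideal_vimage) (rule p.ideal_axioms)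
  moreover have "carrier A \<noteq> pull p"
  proof
    assume "carrier A = pull p"
    then have "k ` carrier A \<subseteq> p" by (auto simp: pull_def)
    then show False using surj p.I_notcarr p.a_subset by auto
  qed
  ultimately show ?thesis
    unfolding pull_def using p.I_prime
    by (intro primeidealI) (auto simp: A.is_cring)
qed

text \<open>The image of a prime is its preimage under the inverse isomorphism, so this is
  \<open>primeideal_pull\<close> with the two rings exchanged.\<close>

lemma primeideal_image:
  assumes "primeideal q A"
  shows "primeideal (k ` q) B"
proof -
  define l where "l = inv_into (carrier A) k"
  interpret inverse: affine_iso B A l
    unfolding l_def by unfold_locales (rule ring_iso_set_sym[OF A.ring_axioms iso])
  have l: "b \<in> carrier B \<Longrightarrow> k (l b) = b" "a \<in> carrier A \<Longrightarrow> l (k a) = a" for a b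
    unfolding l_def using surj by (simp_all add: f_inv_into_f inv_into_f_f inj)
  have sub: "q \<subseteq> carrier A"
    using assms by (simp add: primeideal.axioms(1) ideal.axioms(1) additive_subgroup.a_subset)
  have "k ` q = inverse.pull q"
  proof
    show "k ` q \<subseteq> inverse.pull q"
      using sub by (auto simp: inverse.pull_def l subset_iff)
    show "inverse.pull q \<subseteq> k ` q"
      by (auto simp: inverse.pull_def intro!: image_eqI[of _ k "l _"] simp: l)
  qed
  then show ?thesis using inverse.primeideal_pull[OF assms] by simp
qed

lemma pull_spec: "p \<in> spec_points B \<Longrightarrow> pull p \<in> spec_points A"
  by (simp add: spec_points_def primeideal_pull)

lemma bij_betw_pull: "bij_betw pull (spec_points B) (spec_points A)"
  by (rule bij_betw_byWitness[where f' = "(`) k"])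
    (auto simp: image_pull pull_image spec_points_sub spec_points_sub pull_spec,
     auto simp: spec_points_def primeideal_image)

text \<open>Every element of \<open>B\<close> is a value of \<open>k\<close>, and since \<open>k\<close> is injective the equation that defines a
  fraction holds in \<open>A\<close> as soon as it holds for the images in \<open>B\<close>.\<close>

lemma push_loc_frac:
  assumes "a \<in> carrier A" "f \<in> carrier A"
  shows "push_frac (loc_frac A (pull p) a f) = loc_frac B p (k a) (k f)" (is "?L = ?R")
proof
  show "?L \<subseteq> ?R"
  proof
    fix z assume "z \<in> ?L"
    then obtain b g h where z: "z = (k b, k g)" "b \<in> carrier A" "g \<in> carrier A - pull p"
      "h \<in> carrier A - pull p" "h \<otimes>\<^bsub>A\<^esub> (g \<otimes>\<^bsub>A\<^esub> a) = h \<otimes>\<^bsub>A\<^esub> (f \<otimes>\<^bsub>A\<^esub> b)"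
      by (auto simp: push_frac_def loc_frac_def)
    have c: "g \<in> carrier A" "h \<in> carrier A" using z(3,4) by auto
    have "k h \<otimes>\<^bsub>B\<^esub> (k g \<otimes>\<^bsub>B\<^esub> k a) = k h \<otimes>\<^bsub>B\<^esub> (k f \<otimes>\<^bsub>B\<^esub> k b)"
      using arg_cong[OF z(5), of k] by (simp only: c z(2) assms A.m_closed hom.hom_mult)
    then show "z \<in> ?R" using z by (auto simp: loc_frac_def pull_def intro!: bexI[of _ "k h"])
  qed
  show "?R \<subseteq> ?L"
  proof
    fix z assume "z \<in> ?R"
    then obtain b' g' h' where z: "z = (b', g')" "b' \<in> carrier B" "g' \<in> carrier B - p"
      "h' \<in> carrier B - p" "h' \<otimes>\<^bsub>B\<^esub> (g' \<otimes>\<^bsub>B\<^esub> k a) = h' \<otimes>\<^bsub>B\<^esub> (k f \<otimes>\<^bsub>B\<^esub> b')"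
      by (auto simp: loc_frac_def)
    then obtain b g h where w: "b \<in> carrier A" "g \<in> carrier A" "h \<in> carrier A"
      "b' = k b" "g' = k g" "h' = k h"
      using lift by (metis (lifting) Diff_iff)
    have "k (h \<otimes>\<^bsub>A\<^esub> (g \<otimes>\<^bsub>A\<^esub> a)) = k (h \<otimes>\<^bsub>A\<^esub> (f \<otimes>\<^bsub>A\<^esub> b))"
      using z(5) by (simp only: w(4-6) w(1-3) assms A.m_closed hom.hom_mult)
    then have "h \<otimes>\<^bsub>A\<^esub> (g \<otimes>\<^bsub>A\<^esub> a) = h \<otimes>\<^bsub>A\<^esub> (f \<otimes>\<^bsub>A\<^esub> b)"
      by (simp only: k_eq_iff w(1-3) assms A.m_closed)
    then have "(b, g) \<in> loc_frac A (pull p) a f"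
      using z w by (auto simp: loc_frac_def pull_def)
    then show "z \<in> ?L" using z w by (force simp: push_frac_def)
  qed
qed

lemma loc_frac_sub: "loc_frac A q a f \<subseteq> carrier A \<times> carrier A"
  by (auto simp: loc_frac_def)

lemma localization_carrier_sub:
  "x \<in> carrier (localization A q) \<Longrightarrow> x \<subseteq> carrier A \<times> carrier A"
  by (auto simp: localization_def loc_frac_def)

text \<open>Sums and products in a localization are unions over all representatives of the operands; such a
  union is transported when the fractions that it unites are.\<close>

lemma push_frac_Union:
  assumes "x \<subseteq> carrier A \<times> carrier A" "y \<subseteq> carrier A \<times> carrier A"
    and "\<And>a f b g. a \<in> carrier A \<Longrightarrow> f \<in> carrier A \<Longrightarrow> b \<in> carrier A \<Longrightarrow> g \<in> carrier A
      \<Longrightarrow> push_frac (F a f b g) = G (k a) (k f) (k b) (k g)"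
  shows "push_frac (\<Union>(a, f)\<in>x. \<Union>(b, g)\<in>y. F a f b g) =
    (\<Union>(a, f)\<in>push_frac x. \<Union>(b, g)\<in>push_frac y. G a f b g)"
proof -
  have "push_frac (\<Union>(a, f)\<in>x. \<Union>(b, g)\<in>y. F a f b g) =
      (\<Union>(a, f)\<in>x. \<Union>(b, g)\<in>y. push_frac (F a f b g))"
    by (simp add: push_frac_def image_UN split_def)
  also have "\<dots> = (\<Union>(a, f)\<in>x. \<Union>(b, g)\<in>y. G (k a) (k f) (k b) (k g))"
    using assms by (intro SUP_cong refl) (auto intro!: SUP_cong simp: subset_iff)
  also have "\<dots> = (\<Union>(a, f)\<in>push_frac x. \<Union>(b, g)\<in>push_frac y. G a f b g)"
    by (simp add: push_frac_def split_def)
  finally show ?thesis .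
qed

lemma push_mult:
  assumes "x \<in> carrier (localization A (pull p))" "y \<in> carrier (localization A (pull p))"
  shows "push_frac (x \<otimes>\<^bsub>localization A (pull p)\<^esub> y) = push_frac x \<otimes>\<^bsub>localization B p\<^esub> push_frac y"
  unfolding localization_def ring.simps monoid.simps
  using assms[THEN localization_carrier_sub]
  by (rule push_frac_Union) (simp add: push_loc_frac)

lemma push_add:
  assumes "x \<in> carrier (localization A (pull p))" "y \<in> carrier (localization A (pull p))"
  shows "push_frac (x \<oplus>\<^bsub>localization A (pull p)\<^esub> y) = push_frac x \<oplus>\<^bsub>localization B p\<^esub> push_frac y"
  unfolding localization_def ring.simps monoid.simps
  using assms[THEN localization_carrier_sub]
  by (rule push_frac_Union) (simp add: push_loc_frac)

lemma push_one: "push_frac \<one>\<^bsub>localization A (pull p)\<^esub> = \<one>\<^bsub>localization B p\<^esub>"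
  by (simp add: localization_def push_loc_frac)

lemma push_closed:
  "x \<in> carrier (localization A (pull p)) \<Longrightarrow> push_frac x \<in> carrier (localization B p)"
  by (auto simp: localization_def push_loc_frac) (auto simp: pull_def)

lemma push_surj:
  assumes "y \<in> carrier (localization B p)"
  obtains x where "x \<in> carrier (localization A (pull p))" "push_frac x = y"
proof -
  obtain a f where y: "y = loc_frac B p a f" "a \<in> carrier B" "f \<in> carrier B - p"
    using assms by (auto simp: localization_def)
  then obtain a' f' where "a' \<in> carrier A" "f' \<in> carrier A" "a = k a'" "f = k f'"
    using y(2,3) lift by (metis (lifting) Diff_iff)
  moreover from this have "f' \<notin> pull p" using y by (auto simp: pull_def)
  ultimately have "loc_frac A (pull p) a' f' \<in> carrier (localization A (pull p))"
    "push_frac (loc_frac A (pull p) a' f') = y"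
    using y by (auto simp: localization_def push_loc_frac)
  then show thesis by (rule that)
qed

lemma push_inj:
  assumes "x \<subseteq> carrier A \<times> carrier A" "y \<subseteq> carrier A \<times> carrier A" "push_frac x = push_frac y"
  shows "x = y"
proof -
  have "inj_on (map_prod k k) (carrier A \<times> carrier A)"
    by (intro map_prod_inj_on inj)
  then show ?thesis
    using assms unfolding push_frac_def by (metis inj_on_image_eq_iff)
qed

definition preim :: "'a set set \<Rightarrow> 'b set set" where
  "preim U = {p \<in> spec_points B. pull p \<in> U}"

lemma subset_pull_iff: "S \<subseteq> carrier A \<Longrightarrow> S \<subseteq> pull p \<longleftrightarrow> k ` S \<subseteq> p"
  by (auto simp: pull_def)

lemma open_preim: "zariski_open A U \<Longrightarrow> zariski_open B (preim U)"
  unfolding zariski_open_def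
proof (elim exE conjE)
  fix S assume S: "S \<subseteq> carrier A" "U = spec_points A - {p \<in> spec_points A. S \<subseteq> p}"
  then have "preim U = spec_points B - {p \<in> spec_points B. k ` S \<subseteq> p}"
    by (auto simp: preim_def pull_spec subset_pull_iff)
  then show "\<exists>S\<subseteq>carrier B. preim U = spec_points B - {p \<in> spec_points B. S \<subseteq> p}"
    using S surj by (intro exI[of _ "k ` S"]) auto
qed

lemma pull_preim: "U \<subseteq> spec_points A \<Longrightarrow> pull ` preim U = U"
proof -
  assume "U \<subseteq> spec_points A"
  moreover have "pull ` spec_points B = spec_points A"
    using bij_betw_pull by (simp add: bij_betw_def)
  ultimately have "U \<subseteq> pull ` spec_points B" by simp
  then show ?thesis by (auto simp: preim_def)
qed

lemma open_image: "zariski_open B V \<Longrightarrow> zariski_open A (pull ` V)"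
  unfolding zariski_open_def
proof (elim exE conjE)
  fix T assume T: "T \<subseteq> carrier B" "V = spec_points B - {p \<in> spec_points B. T \<subseteq> p}"
  have kS: "k ` pull T = T" using T image_pull by blast
  have "V = preim (spec_points A - {p \<in> spec_points A. pull T \<subseteq> p})"
    using T kS subset_pull_iff[of "pull T"]
    by (auto simp: preim_def pull_spec pull_def[of T])
  then have "pull ` V = spec_points A - {p \<in> spec_points A. pull T \<subseteq> p}"
    using pull_preim by simp
  then show "\<exists>S\<subseteq>carrier A. pull ` V = spec_points A - {p \<in> spec_points A. S \<subseteq> p}"
    by (intro exI[of _ "pull T"]) (auto simp: pull_def)
qed

lemma homeomorphic_pull: "homeomorphic_map (zariski_topology B) (zariski_topology A) pull"
proof (rule bijective_open_imp_homeomorphic_map)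
  show "continuous_map (zariski_topology B) (zariski_topology A) pull"
    using open_preim
    by (auto simp: continuous_map_def openin_zariski topspace_zariski A.is_cring B.is_cring
      pull_spec preim_def)
  show "open_map (zariski_topology B) (zariski_topology A) pull"
    using open_image by (auto simp: open_map_def openin_zariski)
qed (use bij_betw_pull in
  \<open>auto simp: topspace_zariski A.is_cring B.is_cring bij_betw_def\<close>)

definition push_section :: "'a set set \<Rightarrow> ('a set \<Rightarrow> ('a \<times> 'a) set) \<Rightarrow> ('b set \<Rightarrow> ('b \<times> 'b) set)" where
  "push_section U s = (\<lambda>p\<in>preim U. push_frac (s (pull p)))"

lemma section_value:
  assumes "s \<in> carrier (structure_sections A U)" "p \<in> preim U"
  shows "s (pull p) \<in> carrier (localization A (pull p))"
  using assms by (auto simp: structure_sections_def preim_def)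

lemma push_section_closed:
  assumes s: "s \<in> carrier (structure_sections A U)"
  shows "push_section U s \<in> carrier (structure_sections B (preim U))"
proof -
  have "\<exists>V a f. openin (zariski_topology B) V \<and> p \<in> V \<and> V \<subseteq> preim U \<and>
      a \<in> carrier B \<and> f \<in> carrier B \<and> (\<forall>q\<in>V. f \<notin> q \<and> push_section U s q = loc_frac B q a f)"
    if p: "p \<in> preim U" for p
  proof -
    have "pull p \<in> U" using p by (simp add: preim_def)
    then obtain V a f where V: "zariski_open A V" "pull p \<in> V" "V \<subseteq> U" "a \<in> carrier A"
      "f \<in> carrier A" "\<forall>q\<in>V. f \<notin> q \<and> s q = loc_frac A q a f"
      using s by (auto simp: structure_sections_def openin_zariski)
    have "p \<in> preim V" and sub: "preim V \<subseteq> preim U"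
      using V(2,3) p by (auto simp: preim_def)
    have "k f \<notin> q \<and> push_section U s q = loc_frac B q (k a) (k f)" if "q \<in> preim V" for q
    proof -
      have q: "pull q \<in> V" "q \<in> preim U" using that V(3) by (auto simp: preim_def)
      then have "f \<notin> pull q" and s: "s (pull q) = loc_frac A (pull q) a f" using V(6) by auto
      then have "k f \<notin> q" using V(5) by (auto simp: pull_def)
      then show ?thesis using q s V(4,5) by (simp add: push_section_def push_loc_frac)
    qed
    then show ?thesis
      using V(3-5) open_preim[OF V(1)] hom.hom_closed \<open>p \<in> preim V\<close> unfolding openin_zariski
      by (intro exI[of _ "preim V"] exI[of _ "k a"] exI[of _ "k f"]) (simp add: sub)
  qed
  moreover have "push_section U s \<in> (\<Pi>\<^sub>E p\<in>preim U. carrier (localization B p))"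
    using section_value[OF s] by (auto simp: push_section_def push_closed)
  ultimately show ?thesis by (simp add: structure_sections_def)
qed

text \<open>The preimage of a section is chosen pointwise. It is locally a fraction again because
  \<open>push_frac\<close> is injective: on an open set where the given section is the fraction of \<open>k a\<close> and
  \<open>k f\<close>, the chosen values can only be those of the fraction of \<open>a\<close> and \<open>f\<close>.\<close>

lemma push_section_surj:
  assumes U: "U \<subseteq> spec_points A" and t: "t \<in> carrier (structure_sections B (preim U))"
  shows "\<exists>s \<in> carrier (structure_sections A U). push_section U s = t"
proof -
  have tv: "t p \<in> carrier (localization B p)" if "p \<in> preim U" for p
    using t that by (auto simp: structure_sections_def)
  \<comment> \<open>Outside \<open>U\<close> the section must have the default value \<open>undefined\<close>.\<close>
  define s where "s = (\<lambda>q\<in>U. SOME x. x \<in> carrier (localization A q) \<and> push_frac x = t (k ` q))"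
  have qq: "pull (k ` q) = q" "k ` q \<in> preim U" if "q \<in> U" for q
  proof -
    have q: "q \<in> spec_points A" using that U by auto
    then show "pull (k ` q) = q" by (intro pull_image spec_points_sub)
    then show "k ` q \<in> preim U"
      using q that primeideal_image by (simp add: preim_def spec_points_def)
  qed
  have s: "s q \<in> carrier (localization A q) \<and> push_frac (s q) = t (k ` q)" if "q \<in> U" for q
  proof -
    have "\<exists>x. x \<in> carrier (localization A q) \<and> push_frac x = t (k ` q)"
      using push_surj[OF tv[OF qq(2)[OF that]]] unfolding qq(1)[OF that] by blast
    from someI_ex[OF this] show ?thesis using that by (simp add: s_def)
  qed
  have "push_section U s = t"
  proof
    fix p
    show "push_section U s p = t p"
    proof (cases "p \<in> preim U")
      case True
      then have "pull p \<in> U" "k ` pull p = p"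
        by (auto simp: preim_def image_pull spec_points_sub)
      then show ?thesis using s[of "pull p"] True by (simp add: push_section_def)
    next
      case False
      then show ?thesis using t
        by (auto simp: push_section_def structure_sections_def PiE_def extensional_def)
    qed
  qed
  moreover have "s \<in> carrier (structure_sections A U)"
  proof -
    have "\<exists>V a f. openin (zariski_topology A) V \<and> q \<in> V \<and> V \<subseteq> U \<and>
      a \<in> carrier A \<and> f \<in> carrier A \<and> (\<forall>q\<in>V. f \<notin> q \<and> s q = loc_frac A q a f)"
      if q: "q \<in> U" for q
    proof -
      obtain V a' f' where V: "zariski_open B V" "k ` q \<in> V" "V \<subseteq> preim U" "a' \<in> carrier B"
        "f' \<in> carrier B" "\<forall>p\<in>V. f' \<notin> p \<and> t p = loc_frac B p a' f'"
        using t qq(2)[OF q] by (auto simp: structure_sections_def openin_zariski)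
      obtain a f where af: "a \<in> carrier A" "f \<in> carrier A" "a' = k a" "f' = k f"
        using V(4,5) lift by metis
      have VB: "V \<subseteq> spec_points B" using V(1) zariski_open_sub by blast
      have "f \<notin> pull p \<and> s (pull p) = loc_frac A (pull p) a f" if p: "p \<in> V" for p
      proof
        have pU: "pull p \<in> U" using p V(3) by (auto simp: preim_def)
        have "p \<in> spec_points B" using p VB by auto
        then have kp: "k ` pull p = p" by (intro image_pull spec_points_sub)
        show "f \<notin> pull p" using p V(6) af by (auto simp: pull_def)
        have "push_frac (s (pull p)) = push_frac (loc_frac A (pull p) a f)"
          using s[OF pU] kp p V(6) af by (simp add: push_loc_frac)
        then show "s (pull p) = loc_frac A (pull p) a f"
          using s[OF pU] by (intro push_inj localization_carrier_sub loc_frac_sub) auto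
      qed
      moreover have "q \<in> pull ` V" using V(2) qq(1)[OF q] by force
      moreover have "pull ` V \<subseteq> U" using V(3) by (auto simp: preim_def)
      ultimately show ?thesis
        using open_image[OF V(1)] af unfolding openin_zariski
        by (intro exI[of _ "pull ` V"] exI[of _ a] exI[of _ f]) auto
    qed
    then show ?thesis
      using s by (auto simp: structure_sections_def) (auto simp: s_def)
  qed
  ultimately show ?thesis by blast
qed

lemma push_section_inj:
  assumes U: "U \<subseteq> spec_points A"
  shows "inj_on (push_section U) (carrier (structure_sections A U))"
proof (rule inj_onI)
  fix s t assume s: "s \<in> carrier (structure_sections A U)" and t: "t \<in> carrier (structure_sections A U)"
    and eq: "push_section U s = push_section U t"
  show "s = t"
  proof (rule PiE_ext)
    show "s \<in> (\<Pi>\<^sub>E p\<in>U. carrier (localization A p))" "t \<in> (\<Pi>\<^sub>E p\<in>U. carrier (localization A p))"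
      using s t by (auto simp: structure_sections_def)
    fix q assume "q \<in> U"
    then obtain p where p: "p \<in> preim U" "q = pull p"
      using U pull_preim by blast
    then have "push_frac (s q) = push_frac (t q)"
      using fun_cong[OF eq, of p] by (simp add: push_section_def)
    then show "s q = t q"
      using section_value[OF s p(1)] section_value[OF t p(1)] p(2)
      by (intro push_inj localization_carrier_sub) auto
  qed
qed

lemma push_section_iso:
  assumes U: "U \<subseteq> spec_points A"
  shows "push_section U \<in> ring_iso (structure_sections A U) (structure_sections B (preim U))"
proof (rule ring_iso_memI)
  show "bij_betw (push_section U) (carrier (structure_sections A U))
      (carrier (structure_sections B (preim U)))"
    using push_section_closed push_section_inj[OF U] push_section_surj[OF U]
    by (fastforce simp: bij_betw_def)
  show "push_section U \<one>\<^bsub>structure_sections A U\<^esub> = \<one>\<^bsub>structure_sections B (preim U)\<^esub>"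
    by (auto simp: push_section_def structure_sections_def push_one preim_def fun_eq_iff)
next
  fix s t assume s: "s \<in> carrier (structure_sections A U)" and t: "t \<in> carrier (structure_sections A U)"
  have v: "s (pull p) \<in> carrier (localization A (pull p))" "t (pull p) \<in> carrier (localization A (pull p))"
    "pull p \<in> U" if "p \<in> preim U" for p
    using section_value[OF s that] section_value[OF t that] that by (auto simp: preim_def)
  show "push_section U (s \<otimes>\<^bsub>structure_sections A U\<^esub> t) =
      push_section U s \<otimes>\<^bsub>structure_sections B (preim U)\<^esub> push_section U t"
    using v by (auto simp: push_section_def structure_sections_def push_mult fun_eq_iff)
  show "push_section U (s \<oplus>\<^bsub>structure_sections A U\<^esub> t) =
      push_section U s \<oplus>\<^bsub>structure_sections B (preim U)\<^esub> push_section U t"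
    using v by (auto simp: push_section_def structure_sections_def push_add fun_eq_iff)
qed (rule push_section_closed)

lemma Spec_isomorphic_over:
  assumes "\<And>c. \<iota> c \<in> carrier A" and "\<And>c. k (\<iota> c) = \<kappa> c"
  shows "isomorphic_over (Spec B \<kappa>) (Spec A \<iota>)"
proof -
  have sub: "U \<subseteq> spec_points A" if "openin (zariski_topology A) U" for U
    using that zariski_open_sub by (simp add: openin_zariski)
  have pre: "{p \<in> spec_points B. pull p \<in> U} = preim U" for U
    by (simp add: preim_def)
  have "push_section V (restrict s V) = restrict (push_section U s) (preim V)" if "V \<subseteq> U" for s U V
    using that by (auto simp: push_section_def preim_def fun_eq_iff)
  moreover have "push_section (spec_points A) (\<lambda>p\<in>spec_points A. loc_frac A p (\<iota> c) \<one>\<^bsub>A\<^esub>) =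
      (\<lambda>p\<in>spec_points B. loc_frac B p (\<kappa> c) \<one>\<^bsub>B\<^esub>)" for c
    using assms pull_spec
    by (auto simp: push_section_def preim_def push_loc_frac fun_eq_iff)
  ultimately show ?thesis
    unfolding isomorphic_over_def Let_def Spec_def ringed_space_over.simps
    using homeomorphic_pull push_section_iso[OF sub]
    by (intro exI[of _ pull] exI[of _ push_section])
      (simp add: topspace_zariski A.is_cring B.is_cring pre)
qed

end

section \<open>Substitution of parameters\<close>

lemma monomial_product_superset:
  assumes "finite S" "Poly_Mapping.keys m \<subseteq> S"
  shows "(\<Prod>v\<in>Poly_Mapping.keys m. e v ^ Poly_Mapping.lookup m v) =
    (\<Prod>v\<in>S. (e v :: 'a::comm_ring_1) ^ Poly_Mapping.lookup m v)"
  using assms by (intro prod.mono_neutral_left) (auto simp: in_keys_iff)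

definition monomial_value :: "('v \<Rightarrow> 'a::comm_ring_1) \<Rightarrow> ('v \<Rightarrow>\<^sub>0 nat) \<Rightarrow> 'a" where
  "monomial_value e m = (\<Prod>v\<in>Poly_Mapping.keys m. e v ^ Poly_Mapping.lookup m v)"

lemma monomial_value_add: "monomial_value e (m + n) = monomial_value e m * monomial_value e n"
proof -
  let ?S = "Poly_Mapping.keys m \<union> Poly_Mapping.keys n"
  have "Poly_Mapping.keys (m + n) \<subseteq> ?S" by (rule keys_add)
  then show ?thesis unfolding monomial_value_def
    by (subst (1 2 3) monomial_product_superset[of ?S]) (auto simp: lookup_add power_add prod.distrib)
qed

lemma monomial_value_0 [simp]: "monomial_value e 0 = 1"
  by (simp add: monomial_value_def)

lemma monomial_value_single: "monomial_value e (Poly_Mapping.single v 1) = e v"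
  by (simp add: monomial_value_def)

definition pvar :: "'v \<Rightarrow> (('v \<Rightarrow>\<^sub>0 nat) \<Rightarrow>\<^sub>0 'k::comm_ring_1)" where
  "pvar v = Poly_Mapping.single (Poly_Mapping.single v 1) 1"

definition substitute :: "('v \<Rightarrow> ('v \<Rightarrow>\<^sub>0 nat) \<Rightarrow>\<^sub>0 'k) \<Rightarrow> (('v \<Rightarrow>\<^sub>0 nat) \<Rightarrow>\<^sub>0 'k)
    \<Rightarrow> (('v \<Rightarrow>\<^sub>0 nat) \<Rightarrow>\<^sub>0 'k::comm_ring_1)" where
  "substitute e f = (\<Sum>m\<in>Poly_Mapping.keys f. Poly_Mapping.single 0 (Poly_Mapping.lookup f m) * monomial_value e m)"

lemma substitute_superset:
  assumes "finite S" "Poly_Mapping.keys f \<subseteq> S"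
  shows "substitute e f = (\<Sum>m\<in>S. Poly_Mapping.single 0 (Poly_Mapping.lookup f m) * monomial_value e m)"
  unfolding substitute_def using assms by (intro sum.mono_neutral_left) (auto simp: in_keys_iff)

lemma substitute_add: "substitute e (f + g) = substitute e f + substitute e g"
proof -
  let ?S = "Poly_Mapping.keys f \<union> Poly_Mapping.keys g"
  have "Poly_Mapping.keys (f + g) \<subseteq> ?S" by (rule keys_add)
  then show ?thesis
    by (subst (1 2 3) substitute_superset[of ?S])
      (auto simp: lookup_add single_add distrib_right sum.distrib)
qed

lemma substitute_0 [simp]: "substitute e 0 = 0"
  by (simp add: substitute_def)

lemma substitute_uminus: "substitute e (- f) = - substitute e f"
  using substitute_add[of e "-f" f] by (simp add: eq_neg_iff_add_eq_0)

lemma substitute_diff: "substitute e (f - g) = substitute e f - substitute e g"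
  using substitute_add[of e f "-g"] by (simp add: substitute_uminus)

lemma substitute_sum: "substitute e (sum f S) = (\<Sum>x\<in>S. substitute e (f x))"
  by (induction S rule: infinite_finite_induct) (auto simp: substitute_add)

lemma substitute_single: "substitute e (Poly_Mapping.single m a) = Poly_Mapping.single 0 a * monomial_value e m"
  by (cases "a = 0") (auto simp: substitute_def)

lemma substitute_const [simp]: "substitute e (Poly_Mapping.single 0 a) = Poly_Mapping.single 0 a"
  by (simp add: substitute_single)

lemma substitute_1 [simp]: "substitute e 1 = 1"
  using substitute_const[of e 1] by simp

lemma poly_mapping_sum_single:
  "f = (\<Sum>m\<in>Poly_Mapping.keys f. Poly_Mapping.single m (Poly_Mapping.lookup f m))"
  by (rule poly_mapping_eqI) (simp add: lookup_sum lookup_single when_def in_keys_iff)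

text \<open>Both sides are additive in each factor, so it is enough to compare them on products of
  monomials.\<close>

lemma substitute_mult: "substitute e (f * g) = substitute e f * substitute e g"
proof -
  have single: "substitute e (Poly_Mapping.single m a * Poly_Mapping.single n b) =
      substitute e (Poly_Mapping.single m a) * substitute e (Poly_Mapping.single n b)" for m n a b
  proof -
    have "Poly_Mapping.single (0 :: 'a \<Rightarrow>\<^sub>0 nat) (a * b) =
        Poly_Mapping.single 0 a * Poly_Mapping.single 0 b"
      by (simp add: mult_single)
    then show ?thesis
      unfolding mult_single[of m a n b] substitute_single monomial_value_add by (simp only: mult_ac)
  qed
  have *: "substitute e ((\<Sum>m\<in>Poly_Mapping.keys f. Poly_Mapping.single m (Poly_Mapping.lookup f m)) *
        (\<Sum>n\<in>Poly_Mapping.keys g. Poly_Mapping.single n (Poly_Mapping.lookup g n))) =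
      substitute e (\<Sum>m\<in>Poly_Mapping.keys f. Poly_Mapping.single m (Poly_Mapping.lookup f m)) *
        substitute e (\<Sum>n\<in>Poly_Mapping.keys g. Poly_Mapping.single n (Poly_Mapping.lookup g n))"
    by (simp add: sum_product substitute_sum single)
  show ?thesis
    using * by (simp only: poly_mapping_sum_single[symmetric])
qed

text \<open>Substituting each parameter for itself; the lemmas that compare a substitution with the identity
  are instances of comparing it with this one.\<close>

lemma substitute_params: "substitute pvar f = f"
proof -
  have m: "monomial_value pvar m =
    (Poly_Mapping.single m 1 :: ('v \<Rightarrow>\<^sub>0 nat) \<Rightarrow>\<^sub>0 'k::comm_ring_1)" for m :: "'v \<Rightarrow>\<^sub>0 nat"
  proof -
    have pow: "(pvar v :: ('v \<Rightarrow>\<^sub>0 nat) \<Rightarrow>\<^sub>0 'k) ^ n =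
      Poly_Mapping.single (Poly_Mapping.single v n) 1" for v :: 'v and n
      by (induction n) (simp_all add: pvar_def mult_single single_add[symmetric])
    have "(\<Prod>v\<in>S. (Poly_Mapping.single (f v) 1 :: ('v \<Rightarrow>\<^sub>0 nat) \<Rightarrow>\<^sub>0 'k)) =
      Poly_Mapping.single (sum f S) 1" for S :: "'v set" and f
      by (induction S rule: infinite_finite_induct) (simp_all add: mult_single)
    then show ?thesis
      unfolding monomial_value_def pow using poly_mapping_sum_single[of m] by simp
  qed
  show ?thesis
    unfolding substitute_def m
    by (simp add: mult_single poly_mapping_sum_single[symmetric])
qed

section \<open>Parameter rings and congruences modulo their ideals\<close>

lemma in_param_ring_iff:
  "f \<in> carrier (param_ring V) \<longleftrightarrow> (\<forall>m \<in> Poly_Mapping.keys f. Poly_Mapping.keys m \<subseteq> V)"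
  by (simp add: param_ring_def)

locale subring_of_type =
  fixes A :: "'a::comm_ring_1 set"
  assumes one_closed: "1 \<in> A"
    and diff_closed: "a \<in> A \<Longrightarrow> b \<in> A \<Longrightarrow> a - b \<in> A"
    and mult_closed: "a \<in> A \<Longrightarrow> b \<in> A \<Longrightarrow> a * b \<in> A"
begin

lemma zero_closed: "0 \<in> A"
  using diff_closed[OF one_closed one_closed] by simp

lemma uminus_closed: "a \<in> A \<Longrightarrow> - a \<in> A"
  using diff_closed[OF zero_closed] by simp

lemma add_closed: "a \<in> A \<Longrightarrow> b \<in> A \<Longrightarrow> a + b \<in> A"
  using diff_closed[OF _ uminus_closed] by simp

lemma sum_closed: "(\<And>x. x \<in> S \<Longrightarrow> f x \<in> A) \<Longrightarrow> sum f S \<in> A"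
  by (induction S rule: infinite_finite_induct) (auto simp: zero_closed add_closed)

lemma power_closed: "a \<in> A \<Longrightarrow> a ^ n \<in> A"
  by (induction n) (auto simp: one_closed mult_closed)

lemma prod_closed: "(\<And>x. x \<in> S \<Longrightarrow> f x \<in> A) \<Longrightarrow> prod f S \<in> A"
  by (induction S rule: infinite_finite_induct) (auto simp: one_closed mult_closed)

lemmas closed = zero_closed one_closed add_closed diff_closed mult_closed sum_closed

end

lemma subring_param_ring: "subring_of_type (carrier (param_ring V))"
proof
  show "a - b \<in> carrier (param_ring V)"
    if "a \<in> carrier (param_ring V)" "b \<in> carrier (param_ring V)" for a b :: "('a \<Rightarrow>\<^sub>0 nat) \<Rightarrow>\<^sub>0 'b"
  proof -
    have "Poly_Mapping.keys (a - b) \<subseteq> Poly_Mapping.keys a \<union> Poly_Mapping.keys b"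
      by (auto simp: in_keys_iff lookup_minus)
    then show ?thesis using that by (auto simp: in_param_ring_iff)
  qed
  show "a * b \<in> carrier (param_ring V)"
    if a: "a \<in> carrier (param_ring V)" and b: "b \<in> carrier (param_ring V)" for a b :: "('a \<Rightarrow>\<^sub>0 nat) \<Rightarrow>\<^sub>0 'b"
    unfolding in_param_ring_iff
  proof
    fix m assume "m \<in> Poly_Mapping.keys (a * b)"
    then obtain u v where "m = u + v" "u \<in> Poly_Mapping.keys a" "v \<in> Poly_Mapping.keys b"
      using keys_mult by blast
    then show "Poly_Mapping.keys m \<subseteq> V"
      using a b keys_add[of u v] unfolding in_param_ring_iff by fast
  qed
qed (simp add: in_param_ring_iff)

lemma cring_param_ring: "cring (param_ring V)"
proof -
  interpret subring_of_type "carrier (param_ring V)" by (rule subring_param_ring)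
  have s: "mult (param_ring V) = (*)" "one (param_ring V) = 1"
    "add (param_ring V) = (+)" "zero (param_ring V) = 0"
    by (simp_all add: param_ring_def)
  have "abelian_group (param_ring V)"
    by (rule abelian_groupI)
      (auto simp: s closed add_ac intro!: bexI[of _ "- x" for x] uminus_closed)
  moreover have "comm_monoid (param_ring V)"
    by (rule comm_monoidI) (auto simp: s closed mult_ac)
  ultimately show ?thesis
    by (rule cringI) (auto simp: s distrib_right)
qed

lemma const_param_ring: "Poly_Mapping.single 0 a \<in> carrier (param_ring V)"
  by (auto simp: in_param_ring_iff)

lemma var_param_ring: "v \<in> V \<Longrightarrow> pvar v \<in> carrier (param_ring V)"
  by (auto simp: in_param_ring_iff pvar_def split: if_splits)

lemma substitute_closed:
  assumes f: "f \<in> carrier (param_ring V)" and e: "\<And>v. v \<in> V \<Longrightarrow> e v \<in> carrier (param_ring W)"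
  shows "substitute e f \<in> carrier (param_ring W)"
proof -
  interpret subring_of_type "carrier (param_ring W)" by (rule subring_param_ring)
  show ?thesis
    unfolding substitute_def monomial_value_def using f e
    by (auto simp: in_param_ring_iff[of f] subset_iff
      intro!: sum_closed mult_closed const_param_ring prod_closed power_closed)
qed

text \<open>Congruence modulo an ideal \<open>I\<close> of a subring \<open>A\<close>, expressed in the ambient type. Since the two
  parameter rings are subrings of one polynomial type, this allows computations modulo either ideal
  with the elements themselves instead of their residue classes. The subring matters: only factors
  from \<open>A\<close> preserve congruence.\<close>

locale congruence = subring_of_type A for A :: "'a::comm_ring_1 set" +
  fixes I :: "'a set"
  assumes I_zero: "0 \<in> I" and I_add: "x \<in> I \<Longrightarrow> y \<in> I \<Longrightarrow> x + y \<in> I"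
    and I_mult: "a \<in> A \<Longrightarrow> x \<in> I \<Longrightarrow> a * x \<in> I"
begin

definition eqv :: "'a \<Rightarrow> 'a \<Rightarrow> bool" (infix \<open>\<asymp>\<close> 50) where
  "a \<asymp> b \<longleftrightarrow> a - b \<in> I"

lemma eqv_refl [simp]: "a \<asymp> a"
  by (simp add: eqv_def I_zero)

lemma I_uminus: "x \<in> I \<Longrightarrow> - x \<in> I"
  using I_mult[OF uminus_closed[OF one_closed]] by force

lemma eqv_sym: "a \<asymp> b \<Longrightarrow> b \<asymp> a"
  unfolding eqv_def using I_uminus by fastforce

lemma eqv_trans [trans]: "a \<asymp> b \<Longrightarrow> b \<asymp> c \<Longrightarrow> a \<asymp> c"
  unfolding eqv_def using I_add by fastforce

lemma eqv_add: "a \<asymp> b \<Longrightarrow> c \<asymp> d \<Longrightarrow> a + c \<asymp> b + d"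
  unfolding eqv_def using I_add[of "a - b" "c - d"] by (simp add: algebra_simps)

lemma eqv_diff: "a \<asymp> b \<Longrightarrow> c \<asymp> d \<Longrightarrow> a - c \<asymp> b - d"
  unfolding eqv_def using I_add[of "a - b" "- (c - d)"] I_uminus[of "c - d"]
  by (simp add: algebra_simps)

lemma eqv_mult: "a \<in> A \<Longrightarrow> x \<asymp> y \<Longrightarrow> a * x \<asymp> a * y"
  unfolding eqv_def using I_mult by (simp add: right_diff_distrib[symmetric])

lemma eqv_mult_right: "a \<in> A \<Longrightarrow> x \<asymp> y \<Longrightarrow> x * a \<asymp> y * a"
  using eqv_mult by (simp add: mult.commute)

lemma eqv_sum: "(\<And>s. s \<in> S \<Longrightarrow> f s \<asymp> g s) \<Longrightarrow> sum f S \<asymp> sum g S"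
  by (induction S rule: infinite_finite_induct) (auto intro: eqv_add)

lemma eqv_mult2: "a \<asymp> b \<Longrightarrow> c \<asymp> d \<Longrightarrow> b \<in> A \<Longrightarrow> c \<in> A \<Longrightarrow> a * c \<asymp> b * d"
  by (rule eqv_trans[OF eqv_mult_right eqv_mult])

lemma eqv_power: "a \<asymp> b \<Longrightarrow> a \<in> A \<Longrightarrow> b \<in> A \<Longrightarrow> a ^ n \<asymp> b ^ n"
  by (induction n) (auto intro!: eqv_mult2 power_closed)

lemma eqv_prod: "(\<And>s. s \<in> S \<Longrightarrow> f s \<asymp> g s) \<Longrightarrow> (\<And>s. s \<in> S \<Longrightarrow> f s \<in> A) \<Longrightarrow>
    (\<And>s. s \<in> S \<Longrightarrow> g s \<in> A) \<Longrightarrow> prod f S \<asymp> prod g S"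
  by (induction S rule: infinite_finite_induct) (auto intro!: eqv_mult2 prod_closed)

end

lemma congruence_ideal:
  assumes "ideal I (param_ring V)"
  shows "congruence (carrier (param_ring V)) I"
proof -
  interpret subring_of_type "carrier (param_ring V)" by (rule subring_param_ring)
  interpret I: ideal I "param_ring V" by fact
  show ?thesis
  proof
    show "0 \<in> I" using additive_subgroup.zero_closed[OF I.is_additive_subgroup] by (simp add: param_ring_def)
    show "x + y \<in> I" if "x \<in> I" "y \<in> I" for x y
      using additive_subgroup.a_closed[OF I.is_additive_subgroup that] by (simp add: param_ring_def)
    show "a * x \<in> I" if "a \<in> carrier (param_ring V)" "x \<in> I" for a x
      using I.I_l_closed[OF that(2,1)] by (simp add: param_ring_def)
  qed
qed

lemma substitute_eqv:
  assumes "ideal I (param_ring V)" and f: "f \<in> carrier (param_ring V)"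
    and e: "\<And>v. v \<in> V \<Longrightarrow> e v \<in> carrier (param_ring V)"
    and eI: "\<And>v. v \<in> V \<Longrightarrow> e v - pvar v \<in> I"
  shows "substitute e f - f \<in> I"
proof -
  interpret congruence "carrier (param_ring V)" I by (rule congruence_ideal) fact
  have "monomial_value e m \<asymp> monomial_value pvar m"
    if "Poly_Mapping.keys m \<subseteq> V" for m
    unfolding monomial_value_def using that e eI
    by (intro eqv_prod eqv_power power_closed var_param_ring) (auto simp: eqv_def)
  then have "substitute e f \<asymp> substitute pvar f"
    unfolding substitute_def using f
    by (intro eqv_sum eqv_mult const_param_ring) (auto simp: in_param_ring_iff)
  then show ?thesis by (simp add: substitute_params eqv_def)
qed

lemma substitute_fixes:
  assumes f: "f \<in> carrier (param_ring V)"
    and e: "\<And>v. v \<in> V \<Longrightarrow> e v = pvar v"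
  shows "substitute e f = f"
proof -
  have "substitute e f = substitute pvar f"
    unfolding substitute_def monomial_value_def using f e
    by (intro sum.cong refl arg_cong2[of _ _ _ _ "(*)"] prod.cong)
      (auto simp: in_param_ring_iff subset_iff)
  then show ?thesis by (simp add: substitute_params)
qed

lemma genideal_param_least:
  assumes "ideal J (param_ring V)" and "S \<subseteq> J"
  shows "Idl\<^bsub>param_ring V\<^esub> S \<subseteq> J"
proof -
  interpret cring "param_ring V" by (rule cring_param_ring)
  show ?thesis by (rule genideal_minimal[OF assms])
qed

lemma genideal_param_ideal:
  "S \<subseteq> carrier (param_ring V) \<Longrightarrow> ideal (Idl\<^bsub>param_ring V\<^esub> S) (param_ring V)"
proof -
  interpret cring "param_ring V" by (rule cring_param_ring)
  show "S \<subseteq> carrier (param_ring V) \<Longrightarrow> ideal (Idl\<^bsub>param_ring V\<^esub> S) (param_ring V)"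
    by (rule genideal_ideal)
qed

lemma genideal_param_self: "S \<subseteq> carrier (param_ring V) \<Longrightarrow> S \<subseteq> Idl\<^bsub>param_ring V\<^esub> S"
proof -
  interpret cring "param_ring V" by (rule cring_param_ring)
  show "S \<subseteq> carrier (param_ring V) \<Longrightarrow> S \<subseteq> Idl\<^bsub>param_ring V\<^esub> S"
    by (rule genideal_self)
qed

lemma param_ring_minus:
  assumes "f \<in> carrier (param_ring V)" "g \<in> carrier (param_ring V)"
  shows "f \<ominus>\<^bsub>param_ring V\<^esub> g = f - g"
proof -
  interpret R: cring "param_ring V" by (rule cring_param_ring)
  interpret subring_of_type "carrier (param_ring V)" by (rule subring_param_ring)
  have "- g \<in> carrier (param_ring V)" using assms(2) by (rule uminus_closed)
  moreover have "(- g) \<oplus>\<^bsub>param_ring V\<^esub> g = \<zero>\<^bsub>param_ring V\<^esub>" by (simp add: param_ring_def)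
  ultimately have "\<ominus>\<^bsub>param_ring V\<^esub> g = - g" using assms(2) by (intro R.minus_equality)
  then show ?thesis by (simp add: a_minus_def) (simp add: param_ring_def)
qed

text \<open>Reduces the statement that \<open>\<phi>\<close> maps one ideal into another to the generators of the first.\<close>

lemma ideal_preimage_param:
  assumes J: "ideal J (param_ring W)"
    and closed: "\<And>f. f \<in> carrier (param_ring V) \<Longrightarrow> \<phi> f \<in> carrier (param_ring W)"
    and add: "\<And>f g. \<phi> (f + g) = \<phi> f + \<phi> g" and mult: "\<And>f g. \<phi> (f * g) = \<phi> f * \<phi> g"
    and one: "\<phi> 1 = 1"
  shows "ideal {f \<in> carrier (param_ring V). \<phi> f \<in> J} (param_ring V)"
proof -
  interpret R: cring "param_ring V" by (rule cring_param_ring)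
  interpret S: cring "param_ring W" by (rule cring_param_ring)
  have "\<phi> \<in> ring_hom (param_ring V) (param_ring W)"
    using closed by (intro ring_hom_memI) (auto simp: add mult one, simp_all add: param_ring_def add mult one)
  then interpret ring_hom_ring "param_ring V" "param_ring W" \<phi>
    by (rule ring_hom_ringI2[OF R.ring_axioms S.ring_axioms])
  show ?thesis by (rule ideal_vimage[OF J])
qed

section \<open>Terms and order ideals\<close>

lemma lookup_tvar: "Poly_Mapping.lookup (tvar x) y = (if x = y then 1 else 0)"
  by (simp add: tvar_def lookup_single when_def)

lemma tvar_add_minus: "x \<in> Poly_Mapping.keys t \<Longrightarrow> tvar x + (t - tvar x) = t"
  by (rule poly_mapping_eqI) (auto simp: lookup_add lookup_minus lookup_tvar in_keys_iff)

lemma tdvd_iff_lookup: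
  "tdvd s t \<longleftrightarrow> (\<forall>x. Poly_Mapping.lookup s x \<le> Poly_Mapping.lookup t x)"
proof
  assume le: "\<forall>x. Poly_Mapping.lookup s x \<le> Poly_Mapping.lookup t x"
  have "t = s + (t - s)"
    by (rule poly_mapping_eqI) (simp add: lookup_add lookup_minus le)
  then show "tdvd s t" unfolding tdvd_def by blast
qed (auto simp: tdvd_def lookup_add)

lemma tdvd_refl: "tdvd t t"
  by (simp add: tdvd_iff_lookup)

lemma tdvd_add: "tdvd s (u + s)"
  by (simp add: tdvd_iff_lookup lookup_add)

lemma tdeg_add: "tdeg (s + t) = tdeg s + tdeg t"
  by (simp add: tdeg_def lookup_add sum.distrib)

lemma tdeg_tvar: "tdeg (tvar x) = 1"
  by (simp add: tdeg_def lookup_tvar)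

lemma tdeg_eq_0_iff: "tdeg t = 0 \<longleftrightarrow> t = 0"
  by (auto simp: tdeg_def intro: poly_mapping_eqI)

lemma tdeg_0 [simp]: "tdeg 0 = 0"
  by (simp add: tdeg_def)

lemma term_induct [case_names zero tvar]:
  fixes t :: "'x::finite pterm"
  assumes "P 0" and "\<And>x t. P t \<Longrightarrow> P (tvar x + t)"
  shows "P t"
proof (induction "tdeg t" arbitrary: t)
  case 0
  then show ?case using assms(1) tdeg_eq_0_iff[of t] by simp
next
  case (Suc n)
  then have "t \<noteq> 0" using tdeg_eq_0_iff[of t] by auto
  then obtain x where x: "x \<in> Poly_Mapping.keys t" by fastforce
  then have "tdeg (tvar x + (t - tvar x)) = Suc n" using Suc(2) tvar_add_minus by metis
  then have "n = tdeg (t - tvar x)" by (simp add: tdeg_add tdeg_tvar)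
  from assms(2)[OF Suc(1)[OF this]] show ?case using tvar_add_minus[OF x] by metis
qed

lemma tmin_in_keys: "t \<noteq> 0 \<Longrightarrow> tmin t \<in> Poly_Mapping.keys t"
  unfolding tmin_def by (intro Min_in) auto

lemma tmin_le: "x \<in> Poly_Mapping.keys t \<Longrightarrow> tmin t \<le> x"
  unfolding tmin_def by (intro Min_le) auto

lemma lookup_below_tmin: "x < tmin t \<Longrightarrow> Poly_Mapping.lookup t x = 0"
  using tmin_le[of x t] by (metis in_keys_iff leD)

lemma last_difference:
  fixes \<eta> \<theta> :: "'x::{finite,linorder} pterm"
  assumes "\<eta> \<noteq> \<theta>"
  obtains k where "Poly_Mapping.lookup \<eta> k \<noteq> Poly_Mapping.lookup \<theta> k"
    and "\<And>i. k < i \<Longrightarrow> Poly_Mapping.lookup \<eta> i = Poly_Mapping.lookup \<theta> i"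
proof -
  define S where "S = {x. Poly_Mapping.lookup \<eta> x \<noteq> Poly_Mapping.lookup \<theta> x}"
  have S: "finite S" "S \<noteq> {}" using assms by (auto simp: S_def intro: poly_mapping_eqI)
  have "i \<notin> S" if "Max S < i" for i
    using leD[OF Max_ge[OF S(1), of i]] that by blast
  moreover have "Max S \<in> S" using Max_in[OF S] .
  moreover have "i \<in> S \<longleftrightarrow> Poly_Mapping.lookup \<eta> i \<noteq> Poly_Mapping.lookup \<theta> i" for i
    by (simp add: S_def)
  ultimately show thesis using that[of "Max S"] by metis
qed

text \<open>A number with all digits equal to \<open>D\<close> in base \<open>Suc D\<close> is smaller than the next power of the base.
  The place of a digit is the rank of its index in \<open>X\<close>.\<close>

lemma rank_power_sum:
  fixes X :: "'x::linorder set"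
  assumes "finite X"
  shows "D * (\<Sum>i\<in>X. Suc D ^ card {j \<in> X. j < i}) < Suc D ^ card X"
  using assms
proof (induction X rule: finite_linorder_max_induct)
  case (insert b X)
  have eq: "{j \<in> insert b X. j < i} = {j \<in> X. j < i}" if "i \<in> X" for i
    using insert(2) that by force
  have eqb: "{j \<in> insert b X. j < b} = X" using insert(2) by auto
  have "b \<notin> X" using insert(2) by auto
  have "(\<Sum>i\<in>X. Suc D ^ card {j \<in> insert b X. j < i}) = (\<Sum>i\<in>X. Suc D ^ card {j \<in> X. j < i})"
    by (rule sum.cong) (simp_all only: eq)
  then have "(\<Sum>i\<in>insert b X. Suc D ^ card {j \<in> insert b X. j < i}) =
      Suc D ^ card X + (\<Sum>i\<in>X. Suc D ^ card {j \<in> X. j < i})"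
    by (simp only: sum.insert[OF insert(1) \<open>b \<notin> X\<close>] eqb)
  then show ?case using insert(1,3) \<open>b \<notin> X\<close> by (simp add: distrib_left)
qed simp

text \<open>Exponents are read as digits in base \<open>Suc D\<close>, the largest variable being the leading place.
  Since no digit is bounded, this is additive, but it follows the lexicographic order only under
  the conditions of \<open>lex_weight_less\<close>.\<close>

definition lex_weight :: "nat \<Rightarrow> 'x::{finite,linorder} pterm \<Rightarrow> nat" where
  "lex_weight D t = (\<Sum>x\<in>UNIV. Poly_Mapping.lookup t x * Suc D ^ card {y. y < x})"

lemma lex_weight_add: "lex_weight D (s + t) = lex_weight D s + lex_weight D t"
  by (simp add: lex_weight_def lookup_add distrib_right sum.distrib)

text \<open>One unit in the place of \<open>k\<close> outweighs a gain of \<open>D\<close> in every lower place.\<close>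

lemma lex_weight_less:
  fixes \<eta> \<rho> :: "'x::{finite,linorder} pterm"
  assumes k: "Poly_Mapping.lookup \<eta> k < Poly_Mapping.lookup \<rho> k"
    and above: "\<And>i. k < i \<Longrightarrow> Poly_Mapping.lookup \<eta> i \<le> Poly_Mapping.lookup \<rho> i"
    and below: "\<And>i. i < k \<Longrightarrow> Poly_Mapping.lookup \<eta> i \<le> Poly_Mapping.lookup \<rho> i + D"
  shows "lex_weight D \<eta> < lex_weight D \<rho>"
proof -
  define w :: "'x \<Rightarrow> nat" where "w x = Suc D ^ card {y. y < x}" for x
  have split: "lex_weight D t = (\<Sum>i | i < k. Poly_Mapping.lookup t i * w i) +
      Poly_Mapping.lookup t k * w k + (\<Sum>i | k < i. Poly_Mapping.lookup t i * w i)"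
    for t :: "'x pterm"
  proof -
    have "(UNIV :: 'x set) = {i. i < k} \<union> insert k {i. k < i}" by auto
    then have "lex_weight D t = (\<Sum>i\<in>{i. i < k} \<union> insert k {i. k < i}. Poly_Mapping.lookup t i * w i)"
      by (simp add: lex_weight_def w_def)
    also have "\<dots> = (\<Sum>i | i < k. Poly_Mapping.lookup t i * w i) +
        (\<Sum>i\<in>insert k {i. k < i}. Poly_Mapping.lookup t i * w i)"
      by (rule sum.union_disjoint) auto
    finally show ?thesis by simp
  qed
  have "{j \<in> {i. i < k}. j < i} = {j. j < i}" if "i < k" for i using that by auto
  then have "D * (\<Sum>i | i < k. w i) < w k"
    using rank_power_sum[of "{i. i < k}" D] by (simp add: w_def)
  moreover have "(\<Sum>i | i < k. Poly_Mapping.lookup \<eta> i * w i) \<le>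
      (\<Sum>i | i < k. (Poly_Mapping.lookup \<rho> i + D) * w i)"
    using below by (intro sum_mono mult_right_mono) auto
  then have "(\<Sum>i | i < k. Poly_Mapping.lookup \<eta> i * w i) \<le>
      (\<Sum>i | i < k. Poly_Mapping.lookup \<rho> i * w i) + D * (\<Sum>i | i < k. w i)"
    by (simp add: distrib_right sum.distrib sum_distrib_left)
  moreover have "Suc (Poly_Mapping.lookup \<eta> k) * w k \<le> Poly_Mapping.lookup \<rho> k * w k"
    using k by (intro mult_right_mono) auto
  moreover have "(\<Sum>i | k < i. Poly_Mapping.lookup \<eta> i * w i) \<le> (\<Sum>i | k < i. Poly_Mapping.lookup \<rho> i * w i)"
    using above by (intro sum_mono mult_right_mono) auto
  ultimately show ?thesis unfolding split by simp
qed

text \<open>Truncated subtraction makes the formula for the least common multiple asymmetric; it is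
  nevertheless a multiple of both terms.\<close>

lemma tlcm_factors:
  obtains u v where "tlcm \<alpha> \<beta> = u + \<alpha>" "tlcm \<alpha> \<beta> = v + \<beta>"
proof
  show "tlcm \<alpha> \<beta> = (\<beta> - \<alpha>) + \<alpha>" by (simp add: tlcm_def add.commute)
  show "tlcm \<alpha> \<beta> = (\<alpha> - \<beta>) + \<beta>"
    by (rule poly_mapping_eqI) (simp add: tlcm_def lookup_add lookup_minus)
qed

lemma tlcm_tvar: "i \<noteq> j \<Longrightarrow> tlcm (tvar i + \<sigma>) (tvar j + \<sigma>) = tvar j + (tvar i + \<sigma>)"
  by (rule poly_mapping_eqI) (auto simp: tlcm_def lookup_add lookup_minus lookup_tvar)

lemma tlcm_tvar_left: "tlcm (tvar j + \<alpha>) \<alpha> = tvar j + \<alpha>"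
  by (rule poly_mapping_eqI) (auto simp: tlcm_def lookup_add lookup_minus lookup_tvar)

locale finite_order_ideal =
  fixes \<O> :: "'x::{finite,linorder} pterm set"
  assumes finite_O: "finite \<O>" and order_ideal_O: "order_ideal \<O>"
begin

lemma divisor_closed: "t \<in> \<O> \<Longrightarrow> tdvd s t \<Longrightarrow> s \<in> \<O>"
  using order_ideal_O by (auto simp: order_ideal_def)

lemma factor_closed: "s + t \<in> \<O> \<Longrightarrow> t \<in> \<O>"
  using divisor_closed tdvd_add by blast

lemma zero_in_O: "0 \<in> \<O>"
  using order_ideal_O divisor_closed by (auto simp: order_ideal_def tdvd_iff_lookup)

lemma monomial_ideal_complement: "monomial_ideal_terms (- \<O>) = - \<O>"
  using divisor_closed tdvd_refl by (auto simp: monomial_ideal_terms_def)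

lemma border_iff: "\<alpha> \<in> border \<O> \<longleftrightarrow> \<alpha> \<notin> \<O> \<and> (\<exists>x t. t \<in> \<O> \<and> \<alpha> = tvar x + t)"
  by (auto simp: border_def)

lemma tvar_O: "t \<in> \<O> \<Longrightarrow> tvar x + t \<notin> \<O> \<Longrightarrow> tvar x + t \<in> border \<O>"
  by (auto simp: border_iff)

end

section \<open>Normal forms along a decomposition into cones\<close>

lemma param_eq_pvar: "param \<tau> \<sigma> = pvar (\<tau>, \<sigma>)"
  by (simp add: param_def pvar_def)

definition linear_value :: "('t \<Rightarrow>\<^sub>0 'a::comm_ring_1) \<Rightarrow> ('t \<Rightarrow> 'a) \<Rightarrow> 'a" where
  "linear_value g F = (\<Sum>t\<in>Poly_Mapping.keys g. Poly_Mapping.lookup g t * F t)"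

lemma linear_value_superset:
  assumes "finite S" "Poly_Mapping.keys g \<subseteq> S"
  shows "linear_value g F = (\<Sum>t\<in>S. Poly_Mapping.lookup g t * F t)"
  unfolding linear_value_def using assms by (intro sum.mono_neutral_left) (auto simp: in_keys_iff)

lemma linear_value_diff: "linear_value (f - g) F = linear_value f F - linear_value g F"
proof -
  let ?S = "Poly_Mapping.keys f \<union> Poly_Mapping.keys g"
  have "Poly_Mapping.keys (f - g) \<subseteq> ?S" by (auto simp: in_keys_iff lookup_minus)
  then show ?thesis
    by (subst (1 2 3) linear_value_superset[of ?S])
      (auto simp: lookup_minus left_diff_distrib sum_subtractf)
qed

lemma linear_value_add: "linear_value (f + g) F = linear_value f F + linear_value g F"
  using linear_value_diff[of "f + g" g F] by simp

lemma linear_value_0 [simp]: "linear_value 0 F = 0"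
  by (simp add: linear_value_def)

lemma linear_value_sum: "linear_value (sum f S) F = (\<Sum>x\<in>S. linear_value (f x) F)"
  by (induction S rule: infinite_finite_induct) (auto simp: linear_value_add)

lemma linear_value_single: "linear_value (Poly_Mapping.single t a) F = a * F t"
  by (cases "a = 0") (auto simp: linear_value_def)

lemma monomial_mult_marked_poly:
  fixes O :: "'x pterm set" and a :: "('x, 'k::comm_ring_1) param_poly"
  shows "Poly_Mapping.single \<eta> a * marked_poly \<O> \<alpha> =
    Poly_Mapping.single (\<eta> + \<alpha>) a - (\<Sum>\<sigma>\<in>\<O>. Poly_Mapping.single (\<eta> + \<sigma>) (a * param \<alpha> \<sigma>))"
  by (simp add: marked_poly_def right_diff_distrib mult_single sum_distrib_left)

text \<open>What the border and the Pommaret structure have in common: the terms outside \<open>\<O>\<close> are the disjoint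
  union of the cones of the head terms in \<open>H\<close>, and when a term of a cone is rewritten, the terms
  \<open>\<eta> + \<sigma>\<close> that replace it have multipliers of smaller weight \<open>\<omega>\<close>. The last assumption says this
  for a term \<open>\<rho> + \<sigma>\<close> arising from a multiplier \<open>\<rho>\<close>.\<close>

locale head_decomposition =
  fixes \<O> H :: "'x pterm set" and T :: "'x pterm \<Rightarrow> 'x pterm set" and \<omega> :: "'x pterm \<Rightarrow> nat"
  assumes finite_O: "finite \<O>"
    and decomposition: "t \<notin> \<O> \<Longrightarrow> \<exists>\<alpha>\<in>H. \<exists>\<eta>\<in>T \<alpha>. t = \<eta> + \<alpha>"
    and unique: "\<alpha> \<in> H \<Longrightarrow> \<eta> \<in> T \<alpha> \<Longrightarrow> \<beta> \<in> H \<Longrightarrow> \<theta> \<in> T \<beta> \<Longrightarrow> \<eta> + \<alpha> = \<theta> + \<beta> \<Longrightarrow> \<alpha> = \<beta>"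
    and outside: "\<alpha> \<in> H \<Longrightarrow> \<eta> + \<alpha> \<notin> \<O>"
    and zero_multiplier: "\<alpha> \<in> H \<Longrightarrow> 0 \<in> T \<alpha>"
    and descent: "\<alpha> \<in> H \<Longrightarrow> \<eta> \<in> T \<alpha> \<Longrightarrow> \<sigma> \<in> \<O> \<Longrightarrow> \<eta> + \<alpha> = \<rho> + \<sigma> \<Longrightarrow> \<omega> \<eta> < \<omega> \<rho>"
begin

definition head :: "'x pterm \<Rightarrow> 'x pterm" where
  "head t = (THE \<alpha>. \<alpha> \<in> H \<and> (\<exists>\<eta>\<in>T \<alpha>. t = \<eta> + \<alpha>))"

definition cofactor :: "'x pterm \<Rightarrow> 'x pterm" where
  "cofactor t = t - head t"

text \<open>The successor places all terms outside \<open>\<O>\<close>, even the head terms themselves, above the terms of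
  \<open>\<O>\<close>.\<close>

definition level :: "'x pterm \<Rightarrow> nat" where
  "level t = (if t \<in> \<O> then 0 else Suc (\<omega> (cofactor t)))"

lemma head_cone: "\<alpha> \<in> H \<Longrightarrow> \<eta> \<in> T \<alpha> \<Longrightarrow> head (\<eta> + \<alpha>) = \<alpha>"
  unfolding head_def by (rule the_equality) (auto dest: unique)

lemma cofactor_cone: "\<alpha> \<in> H \<Longrightarrow> \<eta> \<in> T \<alpha> \<Longrightarrow> cofactor (\<eta> + \<alpha>) = \<eta>"
  by (simp add: cofactor_def head_cone)

lemma cone_cases:
  assumes "t \<notin> \<O>"
  obtains \<alpha> \<eta> where "\<alpha> \<in> H" "\<eta> \<in> T \<alpha>" "t = \<eta> + \<alpha>" "head t = \<alpha>" "cofactor t = \<eta>"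
  using decomposition[OF assms] head_cone cofactor_cone by metis

lemma level_multiple: "\<sigma> \<in> \<O> \<Longrightarrow> level (\<rho> + \<sigma>) \<le> \<omega> \<rho>"
proof (cases "\<rho> + \<sigma> \<in> \<O>")
  case False
  assume "\<sigma> \<in> \<O>"
  from False show ?thesis
    by (rule cone_cases) (use \<open>\<sigma> \<in> \<O>\<close> descent in \<open>auto simp: level_def Suc_le_eq\<close>)
qed (simp add: level_def)

text \<open>The coefficient of \<open>\<rho>\<close> in the normal form of \<open>t\<close> if each head term \<open>\<alpha>\<close> is rewritten to the
  combination of the \<open>\<sigma> \<in> \<O>\<close> with coefficients \<open>c \<alpha> \<sigma>\<close>. The recursion does not refer to
  reduction sequences, so congruences between normal forms are proved by induction on the level.\<close>

function normal_form :: "('x pterm \<Rightarrow> 'x pterm \<Rightarrow> 'a::comm_ring_1) \<Rightarrow> 'x pterm \<Rightarrow> 'x pterm \<Rightarrow> 'a" where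
  "normal_form c t \<rho> = (if t \<in> \<O> then (if t = \<rho> then 1 else 0)
    else (\<Sum>\<sigma>\<in>\<O>. c (head t) \<sigma> * normal_form c (cofactor t + \<sigma>) \<rho>))"
  by auto
termination
proof (relation "measure (\<lambda>(c, t, \<rho>). level t)", goal_cases)
  case (2 c t \<rho> \<sigma>)
  then show ?case using level_multiple[of \<sigma> "cofactor t"] by (simp add: level_def)
qed simp

declare normal_form.simps [simp del]

lemma normal_form_O: "t \<in> \<O> \<Longrightarrow> normal_form c t \<rho> = (if t = \<rho> then 1 else 0)"
  by (simp add: normal_form.simps)

lemma normal_form_cone:
  assumes "\<alpha> \<in> H" "\<eta> \<in> T \<alpha>"
  shows "normal_form c (\<eta> + \<alpha>) \<rho> = (\<Sum>\<sigma>\<in>\<O>. c \<alpha> \<sigma> * normal_form c (\<eta> + \<sigma>) \<rho>)"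
  using outside[OF assms(1)]
  by (subst normal_form.simps) (simp add: head_cone[OF assms] cofactor_cone[OF assms])

lemma normal_form_head: "\<alpha> \<in> H \<Longrightarrow> \<rho> \<in> \<O> \<Longrightarrow> normal_form c \<alpha> \<rho> = c \<alpha> \<rho>"
  using normal_form_cone[where \<alpha> = \<alpha> and \<eta> = 0 and c = c and \<rho> = \<rho>] finite_O
  by (simp add: zero_multiplier normal_form_O if_distrib cong: if_cong)

text \<open>The normal form, extended linearly, vanishes on the multiples of marked polynomials that are used
  in reduction. So it is an invariant of reduction, which is what makes reduced forms unique.\<close>

lemma linear_value_reduction_step:
  fixes g g' :: "('x, 'k::comm_ring_1) xpoly"
  assumes "reduction_step \<O> H T g g'"
  shows "linear_value g' (\<lambda>t. normal_form param t \<rho>) = linear_value g (\<lambda>t. normal_form param t \<rho>)"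
  using assms
  by (auto simp: reduction_step_def linear_value_diff monomial_mult_marked_poly linear_value_sum linear_value_single
    normal_form_cone sum_distrib_left mult.assoc)

lemma linear_value_reduction:
  fixes g g' :: "('x, 'k::comm_ring_1) xpoly"
  assumes "(reduction_step \<O> H T)\<^sup>*\<^sup>* g g'"
  shows "linear_value g' (\<lambda>t. normal_form param t \<rho>) = linear_value g (\<lambda>t. normal_form param t \<rho>)"
  using assms by induction (simp_all add: linear_value_reduction_step)

lemma linear_value_supported:
  assumes "Poly_Mapping.keys h \<subseteq> \<O>"
  shows "Poly_Mapping.lookup h \<rho> =
    (if \<rho> \<in> \<O> then linear_value h (\<lambda>t. normal_form c t \<rho>) else 0)"
proof -
  have "linear_value h (\<lambda>t. normal_form c t \<rho>) = (\<Sum>t\<in>\<O>. Poly_Mapping.lookup h t * normal_form c t \<rho>)"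
    using assms finite_O by (rule linear_value_superset[rotated])
  also have "\<dots> = (\<Sum>t\<in>\<O>. if t = \<rho> then Poly_Mapping.lookup h t else 0)"
    by (intro sum.cong) (auto simp: normal_form_O)
  finally show ?thesis using assms finite_O by (auto simp: in_keys_iff)
qed

text \<open>Reducing a term of the highest level \<open>M\<close> removes that term and adds only terms of lower level. So
  the number of terms of level \<open>M\<close> drops, and once there are none the bound \<open>M\<close> itself drops.\<close>

lemma reduction_terminates:
  fixes g :: "('x, 'k::comm_ring_1) xpoly"
  assumes "\<And>t. t \<in> Poly_Mapping.keys g \<Longrightarrow> level t \<le> M"
  shows "\<exists>h. (reduction_step \<O> H T)\<^sup>*\<^sup>* g h \<and> Poly_Mapping.keys h \<subseteq> \<O>"
  using assms
proof (induction M arbitrary: g)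
  case 0
  have "t \<in> \<O>" if "t \<in> Poly_Mapping.keys g" for t
    using 0[OF that] by (auto simp: level_def split: if_splits)
  then show ?case by blast
next
  case (Suc M)
  define top where "top g = {t \<in> Poly_Mapping.keys g. level t = Suc M}" for g :: "('x, 'k) xpoly"
  have "\<exists>h. (reduction_step \<O> H T)\<^sup>*\<^sup>* g h \<and> Poly_Mapping.keys h \<subseteq> \<O>"
    if "\<And>t. t \<in> Poly_Mapping.keys g \<Longrightarrow> level t \<le> Suc M" for g :: "('x, 'k) xpoly"
    using that
  proof (induction "card (top g)" arbitrary: g rule: less_induct)
    case less
    show ?case
    proof (cases "top g = {}")
      case True
      then have "level t \<le> M" if "t \<in> Poly_Mapping.keys g" for t
        using less.prems[OF that] that by (auto simp: top_def le_Suc_eq)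
      then show ?thesis by (rule Suc.IH)
    next
      case False
      then obtain t where t: "t \<in> Poly_Mapping.keys g" "level t = Suc M"
        by (auto simp: top_def)
      then have "t \<notin> \<O>" by (auto simp: level_def)
      then obtain \<alpha> \<eta> where c: "\<alpha> \<in> H" "\<eta> \<in> T \<alpha>" "t = \<eta> + \<alpha>" "cofactor t = \<eta>"
        by (rule cone_cases)
      then have M: "\<omega> \<eta> = M" using t \<open>t \<notin> \<O>\<close> by (simp add: level_def)
      define a where "a = Poly_Mapping.lookup g t"
      define g' where "g' = g - Poly_Mapping.single \<eta> a * marked_poly \<O> \<alpha>"
      have step: "reduction_step \<O> H T g g'"
        unfolding reduction_step_def g'_def a_def using c(1-3) t(1) by blast
      have low: "level (\<eta> + \<sigma>) \<le> M" if "\<sigma> \<in> \<O>" for \<sigma>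
        using level_multiple[OF that, of \<eta>] M by simp
      have look: "Poly_Mapping.lookup g' s = Poly_Mapping.lookup g s -
          (if s = t then a else 0) + (\<Sum>\<sigma>\<in>\<O>. if \<eta> + \<sigma> = s then a * param \<alpha> \<sigma> else 0)" for s
        unfolding g'_def monomial_mult_marked_poly c(3)
        by (auto simp: lookup_minus lookup_sum lookup_single when_def)
      have look': "Poly_Mapping.lookup g' s = Poly_Mapping.lookup g s - (if s = t then a else 0)"
        if "level s = Suc M" for s
      proof -
        have "\<eta> + \<sigma> \<noteq> s" if "\<sigma> \<in> \<O>" for \<sigma> using low[OF that] \<open>level s = Suc M\<close> by auto
        then show ?thesis unfolding look by (simp cong: sum.cong)
      qed
      have top': "top g' \<subseteq> top g - {t}"
        using look' by (auto simp: top_def in_keys_iff a_def split: if_splits)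
      have "finite (top g)" by (simp add: top_def)
      then have card: "card (top g') < card (top g)"
        using top' t by (intro psubset_card_mono) (auto simp: top_def)
      have bound: "level s \<le> Suc M" if "s \<in> Poly_Mapping.keys g'" for s
      proof (rule ccontr)
        assume *: "\<not> level s \<le> Suc M"
        have "\<eta> + \<sigma> \<noteq> s" if "\<sigma> \<in> \<O>" for \<sigma> using low[OF that] * by auto
        moreover have "s \<noteq> t" using * t(2) by auto
        ultimately have "Poly_Mapping.lookup g' s = Poly_Mapping.lookup g s"
          unfolding look by (simp cong: sum.cong)
        then show False using * that less.prems[of s] by (simp add: in_keys_iff)
      qed
      from less.hyps[OF card bound] obtain h where
        "(reduction_step \<O> H T)\<^sup>*\<^sup>* g' h" "Poly_Mapping.keys h \<subseteq> \<O>" by blast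
      with step show ?thesis by (meson converse_rtranclp_into_rtranclp)
    qed
  qed
  then show ?case using Suc.prems by blast
qed

theorem lookup_reduced_form:
  fixes g :: "('x, 'k::comm_ring_1) xpoly"
  shows "Poly_Mapping.lookup (reduced_form \<O> H T g) \<rho> =
    (if \<rho> \<in> \<O> then linear_value g (\<lambda>t. normal_form param t \<rho>) else 0)"
proof -
  define M where "M = Max (insert 0 (level ` Poly_Mapping.keys g))"
  have "level t \<le> M" if "t \<in> Poly_Mapping.keys g" for t
    unfolding M_def using that by (intro Max_ge) auto
  then obtain h where h: "(reduction_step \<O> H T)\<^sup>*\<^sup>* g h" "Poly_Mapping.keys h \<subseteq> \<O>"
    using reduction_terminates by blast
  have val: "Poly_Mapping.lookup h' \<rho> =
      (if \<rho> \<in> \<O> then linear_value g (\<lambda>t. normal_form param t \<rho>) else 0)"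
    if "(reduction_step \<O> H T)\<^sup>*\<^sup>* g h'" "Poly_Mapping.keys h' \<subseteq> \<O>" for h' \<rho>
    by (simp only: linear_value_supported[OF that(2), of \<rho> param] linear_value_reduction[OF that(1)])
  have "reduced_form \<O> H T g = h"
    unfolding reduced_form_def
  proof (rule the_equality)
    fix h' assume "(reduction_step \<O> H T)\<^sup>*\<^sup>* g h' \<and> Poly_Mapping.keys h' \<subseteq> \<O>"
    then show "h' = h" using val h by (intro poly_mapping_eqI) simp
  qed (use h in simp)
  then show ?thesis using val[OF h] by simp
qed

lemma normal_form_closed:
  assumes "subring_of_type A" and "\<And>\<alpha> \<sigma>. \<alpha> \<in> H \<Longrightarrow> \<sigma> \<in> \<O> \<Longrightarrow> c \<alpha> \<sigma> \<in> A"
  shows "normal_form c t \<rho> \<in> A"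
proof -
  interpret subring_of_type A by fact
  show ?thesis
  proof (induction "level t" arbitrary: t rule: less_induct)
    case less
    show ?case
    proof (cases "t \<in> \<O>")
      case True
      then show ?thesis by (simp add: normal_form_O closed)
    next
      case False
      then obtain \<alpha> \<eta> where d: "\<alpha> \<in> H" "\<eta> \<in> T \<alpha>" "t = \<eta> + \<alpha>" "cofactor t = \<eta>"
        by (rule cone_cases)
      have "normal_form c (\<eta> + \<sigma>) \<rho> \<in> A" if "\<sigma> \<in> \<O>" for \<sigma>
        using level_multiple[OF that, of \<eta>] d False by (intro less) (simp add: level_def)
      then show ?thesis
        unfolding d(3) normal_form_cone[OF d(1,2)] using d(1) assms(2) by (intro closed) auto
    qed
  qed
qed

lemma lookup_reduced_s_poly:
  assumes "\<rho> \<in> \<O>" and "u + \<alpha> = v + \<beta>" and "tlcm \<alpha> \<beta> = u + \<alpha>"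
  shows "Poly_Mapping.lookup (reduced_form \<O> H T (s_poly \<O> \<alpha> \<beta>)) \<rho> =
    (\<Sum>\<sigma>\<in>\<O>. param \<beta> \<sigma> * normal_form param (v + \<sigma>) \<rho>)
    - (\<Sum>\<sigma>\<in>\<O>. (param \<alpha> \<sigma> :: ('x, 'k::comm_ring_1) param_poly) * normal_form param (u + \<sigma>) \<rho>)"
proof -
  have "tlcm \<alpha> \<beta> - \<alpha> = u" "tlcm \<alpha> \<beta> - \<beta> = v"
    unfolding assms(3) by (simp, simp add: assms(2))
  then show ?thesis
    using assms(1,2) unfolding lookup_reduced_form s_poly_def
    by (simp add: linear_value_diff monomial_mult_marked_poly linear_value_sum linear_value_single)
qed

text \<open>The head terms of the two summands of an S-polynomial cancel, so only the multiplied tails enter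
  the reduced form. Coefficients of terms outside \<open>\<O>\<close> are zero.\<close>

lemma reduced_s_poly_cases:
  fixes g :: "('x, 'k::comm_ring_1) param_poly"
  assumes "g = Poly_Mapping.lookup (reduced_form \<O> H T (s_poly \<O> \<alpha> \<beta>)) \<rho>"
  obtains "g = 0"
    | u v where "\<rho> \<in> \<O>" "u + \<alpha> = v + \<beta>"
      "g = (\<Sum>\<sigma>\<in>\<O>. param \<beta> \<sigma> * normal_form param (v + \<sigma>) \<rho>)
        - (\<Sum>\<sigma>\<in>\<O>. param \<alpha> \<sigma> * normal_form param (u + \<sigma>) \<rho>)"
proof (cases "\<rho> \<in> \<O>")
  case True
  obtain u v where uv: "tlcm \<alpha> \<beta> = u + \<alpha>" "tlcm \<alpha> \<beta> = v + \<beta>" by (rule tlcm_factors)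
  then have "u + \<alpha> = v + \<beta>" by simp
  from that(2)[OF True this] show ?thesis
    unfolding assms lookup_reduced_s_poly[OF True \<open>u + \<alpha> = v + \<beta>\<close> uv(1)] by blast
next
  case False
  then show ?thesis using that(1) assms by (simp add: lookup_reduced_form)
qed

lemma reduced_s_poly_closed:
  fixes A :: "('x, 'k::comm_ring_1) param_poly set"
  assumes A: "subring_of_type A" and c: "\<And>\<alpha> \<sigma>. \<alpha> \<in> H \<Longrightarrow> \<sigma> \<in> \<O> \<Longrightarrow> param \<alpha> \<sigma> \<in> A"
    and "\<alpha> \<in> H" "\<beta> \<in> H"
  shows "Poly_Mapping.lookup (reduced_form \<O> H T (s_poly \<O> \<alpha> \<beta>)) \<rho> \<in> A"
proof -
  interpret subring_of_type A by fact
  define g where "g = (Poly_Mapping.lookup (reduced_form \<O> H T (s_poly \<O> \<alpha> \<beta>)) \<rho> :: ('x, 'k) param_poly)"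
  from g_def have "g \<in> A"
  proof (cases rule: reduced_s_poly_cases)
    case 1
    then show ?thesis by (simp add: closed)
  next
    case (2 u v)
    show ?thesis
      unfolding 2(3) using assms(3,4) by (intro closed c normal_form_closed[OF A c])
  qed
  then show ?thesis by (simp add: g_def)
qed

end

section \<open>Cones of the Pommaret basis\<close>

context finite_order_ideal
begin

text \<open>An upper bound for the exponents of the border terms; the successor accounts for the variable that
  distinguishes a border term from a term of \<open>\<O>\<close>.\<close>

definition bound :: nat where
  "bound = Suc (\<Sum>t\<in>\<O>. tdeg t)"

lemma lookup_le_tdeg: "Poly_Mapping.lookup t x \<le> tdeg t" for t :: "'x pterm"
  unfolding tdeg_def by (rule member_le_sum) auto

lemma lookup_O_bound: "t \<in> \<O> \<Longrightarrow> Suc (Poly_Mapping.lookup t x) \<le> bound"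
  using lookup_le_tdeg[of t x] member_le_sum[of t \<O> tdeg] finite_O by (simp add: bound_def)

lemma lookup_border_bound: "\<alpha> \<in> border \<O> \<Longrightarrow> Poly_Mapping.lookup \<alpha> x \<le> bound"
  using lookup_O_bound by (fastforce simp: border_iff lookup_add lookup_tvar)

lemma pommaret_iff: "\<alpha> \<in> pommaret_basis \<O> \<longleftrightarrow> \<alpha> \<notin> \<O> \<and> \<alpha> - tvar (tmin \<alpha>) \<in> \<O>"
  by (simp add: pommaret_basis_def monomial_ideal_complement)

lemma pommaret_nonzero: "\<alpha> \<in> pommaret_basis \<O> \<Longrightarrow> \<alpha> \<noteq> 0"
  using zero_in_O by (auto simp: pommaret_iff)

lemma pommaret_tmin: "\<alpha> \<in> pommaret_basis \<O> \<Longrightarrow> 0 < Poly_Mapping.lookup \<alpha> (tmin \<alpha>)"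
  using tmin_in_keys[OF pommaret_nonzero] by (auto simp: in_keys_iff)

lemma pommaret_sub_border: "pommaret_basis \<O> \<subseteq> border \<O>"
proof
  fix \<alpha> assume a: "\<alpha> \<in> pommaret_basis \<O>"
  then have "\<alpha> = tvar (tmin \<alpha>) + (\<alpha> - tvar (tmin \<alpha>))"
    using tvar_add_minus[OF tmin_in_keys[OF pommaret_nonzero]] by metis
  then show "\<alpha> \<in> border \<O>" using a unfolding pommaret_iff border_iff by blast
qed

text \<open>Otherwise \<open>\<beta>\<close> would still divide \<open>\<alpha>\<close> after removal of its smallest variable, and hence lie in
  \<open>\<O>\<close>.\<close>

lemma pommaret_divisor:
  assumes "\<alpha> \<in> pommaret_basis \<O>" "tdvd \<beta> \<alpha>" "\<beta> \<notin> \<O>"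
  shows "Poly_Mapping.lookup \<beta> (tmin \<alpha>) = Poly_Mapping.lookup \<alpha> (tmin \<alpha>)"
proof (rule ccontr)
  assume "Poly_Mapping.lookup \<beta> (tmin \<alpha>) \<noteq> Poly_Mapping.lookup \<alpha> (tmin \<alpha>)"
  then have "tdvd \<beta> (\<alpha> - tvar (tmin \<alpha>))"
    using assms(2) unfolding tdvd_iff_lookup lookup_minus lookup_tvar
    by (metis diff_zero le_neq_implies_less less_Suc_eq_le Suc_pred' One_nat_def bot_nat_0.not_eq_extremum less_nat_zero_code)
  then show False using assms divisor_closed pommaret_iff by blast
qed

text \<open>Removing smallest variables one by one leads from any term outside \<open>\<O>\<close> to an element of the
  Pommaret basis, and each removed variable is at most the smallest variable of what remains.\<close>

lemma pommaret_decomposition: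
  "t \<notin> \<O> \<Longrightarrow> \<exists>\<alpha>\<in>pommaret_basis \<O>. \<exists>\<eta>\<in>pommaret_mult \<alpha>. t = \<eta> + \<alpha>"
proof (induction "tdeg t" arbitrary: t rule: less_induct)
  case less
  then have "t \<noteq> 0" using zero_in_O by auto
  define s where "s = t - tvar (tmin t)"
  have t: "t = tvar (tmin t) + s"
    unfolding s_def using tvar_add_minus[OF tmin_in_keys[OF \<open>t \<noteq> 0\<close>]] by simp
  show ?case
  proof (cases "s \<in> \<O>")
    case True
    then have "t \<in> pommaret_basis \<O>" using less.prems by (simp add: pommaret_iff s_def)
    then show ?thesis by (intro bexI[of _ t] bexI[of _ 0]) (auto simp: pommaret_mult_def)
  next
    case False
    have "tdeg s < tdeg t" using arg_cong[OF t, of tdeg] by (simp add: tdeg_add tdeg_tvar)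
    from less.hyps[OF this False] obtain \<alpha> \<eta> where
      *: "\<alpha> \<in> pommaret_basis \<O>" "\<eta> \<in> pommaret_mult \<alpha>" "s = \<eta> + \<alpha>" by blast
    have "tmin \<alpha> \<in> Poly_Mapping.keys t"
      using pommaret_tmin[OF *(1)] by (subst t) (simp add: *(3) in_keys_iff lookup_add)
    then have "tmin t \<le> tmin \<alpha>" by (rule tmin_le)
    then have "tvar (tmin t) + \<eta> \<in> pommaret_mult \<alpha>"
      using *(2) keys_add[of "tvar (tmin t)" \<eta>]
      by (force simp: pommaret_mult_def tvar_def)
    then show ?thesis using *(1,3) t by (metis add.assoc)
  qed
qed

lemma pommaret_mult_above:
  "\<eta> \<in> pommaret_mult \<alpha> \<Longrightarrow> Poly_Mapping.lookup \<eta> k > 0 \<Longrightarrow> i < k \<Longrightarrow> Poly_Mapping.lookup \<alpha> i = 0"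
  by (rule lookup_below_tmin) (auto simp: pommaret_mult_def in_keys_iff intro: less_le_trans)

lemma cone_lookup:
  "\<eta> + \<alpha> = \<theta> + \<beta> \<Longrightarrow> Poly_Mapping.lookup \<eta> i + Poly_Mapping.lookup \<alpha> i =
    Poly_Mapping.lookup \<theta> i + Poly_Mapping.lookup \<beta> i"
  by (metis lookup_add)

text \<open>Compare two factorizations of a term at the largest variable \<open>k\<close> in which the multipliers differ.
  The larger multiplier contains \<open>k\<close>, so its head contains only variables from \<open>k\<close> on; above \<open>k\<close>
  both heads agree, and at \<open>k\<close> the head of the larger multiplier has the smaller exponent.\<close>

lemma pommaret_larger_divides:
  assumes "\<eta> \<in> pommaret_mult \<alpha>" "\<eta> + \<alpha> = \<theta> + \<beta>"
    and k: "Poly_Mapping.lookup \<theta> k < Poly_Mapping.lookup \<eta> k"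
    and above: "\<And>i. k < i \<Longrightarrow> Poly_Mapping.lookup \<eta> i = Poly_Mapping.lookup \<theta> i"
  shows "tdvd \<alpha> \<beta>" "Poly_Mapping.lookup \<alpha> k < Poly_Mapping.lookup \<beta> k"
    "\<And>i. i < k \<Longrightarrow> Poly_Mapping.lookup \<alpha> i = 0"
proof -
  have "0 < Poly_Mapping.lookup \<eta> k" using k by simp
  then show below: "\<And>i. i < k \<Longrightarrow> Poly_Mapping.lookup \<alpha> i = 0"
    by (rule pommaret_mult_above[OF assms(1)])
  show lt: "Poly_Mapping.lookup \<alpha> k < Poly_Mapping.lookup \<beta> k"
    using cone_lookup[OF assms(2), of k] k by simp
  have "Poly_Mapping.lookup \<alpha> i \<le> Poly_Mapping.lookup \<beta> i" for i
    using below[of i] lt above[of i] cone_lookup[OF assms(2), of i] by (cases i k rule: linorder_cases) auto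
  then show "tdvd \<alpha> \<beta>" by (simp add: tdvd_iff_lookup)
qed

text \<open>If the multipliers differ, one head divides the other with a smaller exponent at \<open>k\<close>. This
  contradicts \<open>pommaret_divisor\<close>, which requires equal exponents at the smallest variable of the
  multiple.\<close>

lemma pommaret_unique:
  assumes "\<alpha> \<in> pommaret_basis \<O>" "\<eta> \<in> pommaret_mult \<alpha>"
    and "\<beta> \<in> pommaret_basis \<O>" "\<theta> \<in> pommaret_mult \<beta>" and eq: "\<eta> + \<alpha> = \<theta> + \<beta>"
  shows "\<alpha> = \<beta>"
proof (cases "\<eta> = \<theta>")
  case True
  then show ?thesis using eq by simp
next
  case False
  have contra: False if a: "\<alpha> \<in> pommaret_basis \<O>" "\<eta> \<in> pommaret_mult \<alpha>" "\<beta> \<in> pommaret_basis \<O>"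
    "\<eta> + \<alpha> = \<theta> + \<beta>" "Poly_Mapping.lookup \<theta> k < Poly_Mapping.lookup \<eta> k"
    "\<And>i. k < i \<Longrightarrow> Poly_Mapping.lookup \<eta> i = Poly_Mapping.lookup \<theta> i" for \<alpha> \<beta> \<eta> \<theta> k
  proof -
    note d = pommaret_larger_divides[OF a(2,4,5,6)]
    have e: "Poly_Mapping.lookup \<alpha> (tmin \<beta>) = Poly_Mapping.lookup \<beta> (tmin \<beta>)"
      using pommaret_divisor[OF a(3) d(1)] a(1) by (simp add: pommaret_iff)
    have "tmin \<beta> \<le> k" using d(2) by (intro tmin_le) (simp add: in_keys_iff)
    then show False using d(2,3) e pommaret_tmin[OF a(3)] by (cases "tmin \<beta> = k") auto
  qed
  from False obtain k where k: "Poly_Mapping.lookup \<eta> k \<noteq> Poly_Mapping.lookup \<theta> k"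
    "\<And>i. k < i \<Longrightarrow> Poly_Mapping.lookup \<eta> i = Poly_Mapping.lookup \<theta> i"
    by (rule last_difference) blast
  then show ?thesis
    using contra[OF assms(1,2,3) eq] contra[OF assms(3,4,1) eq[symmetric]]
    by (metis linorder_neqE_nat)
qed

text \<open>The lexicographic comparison cannot go the other way, since then \<open>\<alpha>\<close> would divide \<open>\<sigma>\<close> and lie in
  \<open>\<O>\<close>. The exponents of \<open>\<eta>\<close> exceed those of \<open>\<rho>\<close> by at most those of \<open>\<sigma>\<close>, so the weight
  follows the lexicographic order here.\<close>

lemma pommaret_descent:
  assumes "\<alpha> \<in> pommaret_basis \<O>" "\<eta> \<in> pommaret_mult \<alpha>" "\<sigma> \<in> \<O>" and eq: "\<eta> + \<alpha> = \<rho> + \<sigma>"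
  shows "lex_weight bound \<eta> < lex_weight bound \<rho>"
proof -
  have "\<alpha> \<notin> \<O>" using assms(1) by (simp add: pommaret_iff)
  then have "\<eta> \<noteq> \<rho>" using assms(3) eq by auto
  then obtain k where k: "Poly_Mapping.lookup \<eta> k \<noteq> Poly_Mapping.lookup \<rho> k"
    "\<And>i. k < i \<Longrightarrow> Poly_Mapping.lookup \<eta> i = Poly_Mapping.lookup \<rho> i"
    by (rule last_difference) blast
  have "\<not> Poly_Mapping.lookup \<rho> k < Poly_Mapping.lookup \<eta> k"
    using pommaret_larger_divides(1)[OF assms(2) eq _ k(2)] divisor_closed assms(3) \<open>\<alpha> \<notin> \<O>\<close> by blast
  then have "Poly_Mapping.lookup \<eta> k < Poly_Mapping.lookup \<rho> k" using k(1) by simp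
  moreover have "Poly_Mapping.lookup \<eta> i \<le> Poly_Mapping.lookup \<rho> i + bound" for i
    using cone_lookup[OF eq, of i] lookup_O_bound[OF assms(3), of i] by simp
  ultimately show ?thesis using k(2) by (intro lex_weight_less[of _ k]) auto
qed

text \<open>A non-multiplicative multiple \<open>tvar k + \<alpha>\<close> lies in the cone of another head, with a multiplier
  that contains only variables below \<open>k\<close>. This is the descent on which the criterion for Pommaret
  marked sets rests.\<close>

lemma pommaret_nonmultiplicative:
  assumes a: "\<alpha> \<in> pommaret_basis \<O>" and b: "\<beta> \<in> pommaret_basis \<O>" "\<theta> \<in> pommaret_mult \<beta>"
    and k: "tvar k \<notin> pommaret_mult \<alpha>" and eq: "tvar k + \<alpha> = \<theta> + \<beta>"
  shows "lex_weight bound \<theta> < lex_weight bound (tvar k)" "tlcm \<alpha> \<beta> = tvar k + \<alpha>"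
proof -
  have k': "tmin \<alpha> < k" using k by (auto simp: pommaret_mult_def tvar_def)
  have look: "(if i = k then 1 else 0) + Poly_Mapping.lookup \<alpha> i =
      Poly_Mapping.lookup \<theta> i + Poly_Mapping.lookup \<beta> i" for i
    using cone_lookup[OF eq, of i] by (auto simp: lookup_tvar)
  \<comment> \<open>A variable of \<open>\<theta>\<close> from \<open>k\<close> on would confine \<open>\<beta>\<close> to variables from there on. Then
    \<open>\<beta>\<close> would divide \<open>\<alpha>\<close> without containing its smallest variable.\<close>
  have zero: "Poly_Mapping.lookup \<theta> i = 0" if "k \<le> i" for i
  proof (rule ccontr)
    assume i: "Poly_Mapping.lookup \<theta> i \<noteq> 0"
    have below: "Poly_Mapping.lookup \<beta> j = 0" if "j < i" for j
      using pommaret_mult_above[OF b(2) _ that] i by simp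
    have "Poly_Mapping.lookup \<beta> j \<le> Poly_Mapping.lookup \<alpha> j" for j
      using look[of j] below[of j] i \<open>k \<le> i\<close> by (cases "j = k"; cases "i = k") auto
    then have "tdvd \<beta> \<alpha>" by (simp add: tdvd_iff_lookup)
    then have "Poly_Mapping.lookup \<beta> (tmin \<alpha>) = Poly_Mapping.lookup \<alpha> (tmin \<alpha>)"
      using b(1) by (intro pommaret_divisor[OF a]) (simp_all add: pommaret_iff)
    then show False using below[of "tmin \<alpha>"] k' \<open>k \<le> i\<close> pommaret_tmin[OF a] by simp
  qed
  have "Poly_Mapping.lookup \<theta> i \<le> bound" if "i < k" for i
  proof -
    have "i \<noteq> k" and "\<alpha> \<in> border \<O>" using that a pommaret_sub_border by auto
    then show ?thesis using look[of i] lookup_border_bound[of \<alpha> i] by simp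
  qed
  then show "lex_weight bound \<theta> < lex_weight bound (tvar k)"
    by (intro lex_weight_less[of _ k]) (auto simp: zero lookup_tvar)
  have "\<beta> - \<alpha> = tvar k"
  proof (rule poly_mapping_eqI)
    fix i
    show "Poly_Mapping.lookup (\<beta> - \<alpha>) i = Poly_Mapping.lookup (tvar k) i"
      using look[of i] zero[of k] by (cases "i = k") (auto simp: lookup_minus lookup_tvar)
  qed
  then show "tlcm \<alpha> \<beta> = tvar k + \<alpha>" by (simp add: tlcm_def add.commute)
qed

lemma pommaret_head_decomposition:
  "head_decomposition \<O> (pommaret_basis \<O>) pommaret_mult (lex_weight bound)"
proof
  show "\<eta> + \<alpha> \<notin> \<O>" if "\<alpha> \<in> pommaret_basis \<O>" for \<alpha> \<eta>
    using that factor_closed pommaret_iff by blast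
qed (use finite_O pommaret_decomposition pommaret_unique pommaret_descent in
  \<open>auto simp: pommaret_mult_def[of _]\<close>)

end

section \<open>Cones of the border\<close>

context finite_order_ideal
begin

text \<open>Multiply \<open>\<sigma>\<close> by the variables of \<open>\<rho>\<close> one after the other: the first product outside \<open>\<O>\<close> is a
  border term, and at least one variable of \<open>\<rho>\<close> has been used up to reach it.\<close>

lemma border_divisor_below:
  assumes "\<sigma> \<in> \<O>" "\<rho> + \<sigma> \<notin> \<O>"
  shows "\<exists>\<beta>\<in>border \<O>. \<exists>\<rho>'. \<rho> + \<sigma> = \<rho>' + \<beta> \<and> tdeg \<rho>' < tdeg \<rho>"
  using assms(2)
proof (induction \<rho> rule: term_induct)
  case zero
  then show ?case using assms(1) by simp
next
  case (tvar x \<rho>)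
  show ?case
  proof (cases "\<rho> + \<sigma> \<in> \<O>")
    case True
    then have "tvar x + (\<rho> + \<sigma>) \<in> border \<O>" using tvar(2) by (intro tvar_O) (auto simp: add.assoc)
    then show ?thesis
      by (intro bexI[of _ "tvar x + (\<rho> + \<sigma>)"] exI[of _ 0]) (auto simp: add.assoc tdeg_add tdeg_tvar tdeg_eq_0_iff)
  next
    case False
    from tvar(1)[OF this] obtain \<beta> \<rho>' where
      "\<beta> \<in> border \<O>" "\<rho> + \<sigma> = \<rho>' + \<beta>" "tdeg \<rho>' < tdeg \<rho>" by blast
    then show ?thesis
      by (intro bexI[of _ \<beta>] exI[of _ "tvar x + \<rho>'"]) (auto simp: add.assoc tdeg_add)
  qed
qed

text \<open>The head of a term is the last border term in the enumeration that divides it. As the enumeration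
  is ordered by degree, this divisor has the greatest possible degree, so its multiplier has the
  smallest.\<close>

lemma border_head_decomposition:
  assumes "border_enumeration \<O> \<tau>s"
  shows "head_decomposition \<O> (border \<O>) (border_mult \<tau>s) tdeg"
proof
  have dist: "distinct \<tau>s" and set: "set \<tau>s = border \<O>" and sorted: "sorted (map tdeg \<tau>s)"
    using assms by (auto simp: border_enumeration_def)
  have mult: "\<eta> \<in> border_mult \<tau>s (\<tau>s ! i) \<longleftrightarrow>
      (\<forall>j. i < j \<longrightarrow> j < length \<tau>s \<longrightarrow> \<not> tdvd (\<tau>s ! j) (\<eta> + \<tau>s ! i))" if "i < length \<tau>s" for \<eta> i
    using that dist by (auto simp: border_mult_def add.commute nth_eq_iff_index_eq)
  show "finite \<O>" by (rule finite_O)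
  show "\<exists>\<alpha>\<in>border \<O>. \<exists>\<eta>\<in>border_mult \<tau>s \<alpha>. t = \<eta> + \<alpha>" if "t \<notin> \<O>" for t
  proof -
    obtain \<beta> \<rho> where b: "\<beta> \<in> border \<O>" "t = \<rho> + \<beta>"
      using border_divisor_below[OF zero_in_O, of t] \<open>t \<notin> \<O>\<close> by auto
    define J where "J = {j. j < length \<tau>s \<and> tdvd (\<tau>s ! j) t}"
    have "finite J" by (simp add: J_def)
    moreover obtain j where "j < length \<tau>s" "\<tau>s ! j = \<beta>" using b(1) set by (metis in_set_conv_nth)
    then have "j \<in> J" using b(2) by (simp add: J_def tdvd_add)
    then have "J \<noteq> {}" by blast
    ultimately have max: "Max J \<in> J" "\<And>j. j \<in> J \<Longrightarrow> j \<le> Max J" using Max_in Max_ge by auto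
    then obtain \<eta> where e: "t = \<eta> + \<tau>s ! Max J" and l: "Max J < length \<tau>s"
      by (auto simp: J_def tdvd_def add.commute)
    have "\<not> tdvd (\<tau>s ! j) t" if "Max J < j" "j < length \<tau>s" for j
    proof -
      have "j \<notin> J" using max(2)[of j] that(1) by auto
      then show ?thesis using that(2) by (simp add: J_def)
    qed
    then have "\<eta> \<in> border_mult \<tau>s (\<tau>s ! Max J)" using mult[OF l] e by simp
    then show ?thesis using e l set nth_mem[OF l] by blast
  qed
  have later: "\<not> i < j" if "i < length \<tau>s" "j < length \<tau>s" "\<eta> \<in> border_mult \<tau>s (\<tau>s ! i)"
    "\<eta> + \<tau>s ! i = \<theta> + \<tau>s ! j" for i j \<eta> \<theta>
    using mult[OF that(1), of \<eta>] that tdvd_add by metis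
  show "\<alpha> = \<beta>" if "\<alpha> \<in> border \<O>" "\<eta> \<in> border_mult \<tau>s \<alpha>" "\<beta> \<in> border \<O>"
    "\<theta> \<in> border_mult \<tau>s \<beta>" "\<eta> + \<alpha> = \<theta> + \<beta>" for \<alpha> \<beta> \<eta> \<theta>
  proof -
    obtain i j where "i < length \<tau>s" "\<alpha> = \<tau>s ! i" "j < length \<tau>s" "\<beta> = \<tau>s ! j"
      using \<open>\<alpha> \<in> border \<O>\<close> \<open>\<beta> \<in> border \<O>\<close> set by (metis in_set_conv_nth)
    then show ?thesis using later[of i j \<eta> \<theta>] later[of j i \<theta> \<eta>] that by (metis linorder_neqE_nat)
  qed
  show "\<eta> + \<alpha> \<notin> \<O>" if "\<alpha> \<in> border \<O>" for \<alpha> \<eta>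
    using that factor_closed border_iff by blast
  have degree: "tdeg (\<tau>s ! i) \<le> tdeg (\<tau>s ! j)" if "i \<le> j" "j < length \<tau>s" for i j
    using sorted_nth_mono[OF sorted, of i j] that by simp
  show "0 \<in> border_mult \<tau>s \<alpha>" if "\<alpha> \<in> border \<O>" for \<alpha>
  proof -
    obtain i where i: "i < length \<tau>s" "\<alpha> = \<tau>s ! i"
      using \<open>\<alpha> \<in> border \<O>\<close> set by (metis in_set_conv_nth)
    have "\<not> tdvd (\<tau>s ! j) (\<tau>s ! i)" if j: "i < j" "j < length \<tau>s" for j
    proof
      assume "tdvd (\<tau>s ! j) (\<tau>s ! i)"
      then obtain u where u: "\<tau>s ! i = \<tau>s ! j + u" by (auto simp: tdvd_def)
      then have "tdeg u = 0" using degree[of i j] j by (simp add: tdeg_add)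
      then have "\<tau>s ! i = \<tau>s ! j" using u by (simp add: tdeg_eq_0_iff)
      then show False using dist j i by (simp add: nth_eq_iff_index_eq)
    qed
    then show ?thesis using mult[OF i(1), of 0] i(2) by simp
  qed
  show "tdeg \<eta> < tdeg \<rho>" if "\<alpha> \<in> border \<O>" "\<eta> \<in> border_mult \<tau>s \<alpha>" "\<sigma> \<in> \<O>" "\<eta> + \<alpha> = \<rho> + \<sigma>"
    for \<alpha> \<eta> \<sigma> \<rho>
  proof -
    have "\<rho> + \<sigma> \<notin> \<O>" using that factor_closed border_iff by metis
    from border_divisor_below[OF \<open>\<sigma> \<in> \<O>\<close> this] obtain \<beta> \<rho>' where
      b: "\<beta> \<in> border \<O>" "\<rho> + \<sigma> = \<rho>' + \<beta>" "tdeg \<rho>' < tdeg \<rho>" by blast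
    obtain i j where ij: "i < length \<tau>s" "\<alpha> = \<tau>s ! i" "j < length \<tau>s" "\<beta> = \<tau>s ! j"
      using \<open>\<alpha> \<in> border \<O>\<close> b(1) set by (metis in_set_conv_nth)
    have "\<eta> + \<alpha> = \<rho>' + \<beta>" using that(4) b(2) by simp
    then have "\<not> i < j" using later[of i j \<eta> \<rho>'] that(2) ij by simp
    then have "tdeg \<beta> \<le> tdeg \<alpha>" using degree[of j i] ij by simp
    moreover have "tdeg \<eta> + tdeg \<alpha> = tdeg \<rho>' + tdeg \<beta>"
      using \<open>\<eta> + \<alpha> = \<rho>' + \<beta>\<close> tdeg_add by metis
    ultimately show ?thesis using b(3) by simp
  qed
qed

end

section \<open>Normal forms of multiples\<close>

context head_decomposition
begin

text \<open>If \<open>t\<close> is \<open>\<eta>\<close> times a head term \<open>\<alpha>\<close>, the claim follows from the case of the head term \<open>\<alpha>\<close> with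
  the multiplier \<open>\<epsilon> + \<eta>\<close>, together with the claim for the terms \<open>\<eta> + \<sigma>\<close> of lower level. The
  bound \<open>W\<close> records which multipliers of head terms occur; it makes the lemma applicable within an
  induction on their weight.\<close>

lemma normal_form_multiple_below:
  assumes "congruence A I" and c: "\<And>\<alpha> \<sigma>. \<alpha> \<in> H \<Longrightarrow> \<sigma> \<in> \<O> \<Longrightarrow> c \<alpha> \<sigma> \<in> A"
    and add: "\<And>s t. \<omega> (s + t) = \<omega> s + \<omega> t"
    and heads: "\<And>\<delta> \<alpha> \<rho>. \<omega> \<delta> \<le> W \<Longrightarrow> \<alpha> \<in> H \<Longrightarrow> \<rho> \<in> \<O> \<Longrightarrow>
      normal_form c (\<delta> + \<alpha>) \<rho> - (\<Sum>\<sigma>\<in>\<O>. c \<alpha> \<sigma> * normal_form c (\<delta> + \<sigma>) \<rho>) \<in> I"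
    and t: "t \<notin> \<O> \<Longrightarrow> \<omega> \<epsilon> + \<omega> (cofactor t) \<le> W" and rho: "\<rho> \<in> \<O>"
  shows "normal_form c (\<epsilon> + t) \<rho> - (\<Sum>\<sigma>\<in>\<O>. normal_form c t \<sigma> * normal_form c (\<epsilon> + \<sigma>) \<rho>) \<in> I"
proof -
  interpret congruence A I by fact
  have "normal_form c (\<epsilon> + t) \<rho> \<asymp> (\<Sum>\<sigma>\<in>\<O>. normal_form c t \<sigma> * normal_form c (\<epsilon> + \<sigma>) \<rho>)"
    using t
  proof (induction "level t" arbitrary: t rule: less_induct)
    case less
    show ?case
    proof (cases "t \<in> \<O>")
      case True
      then show ?thesis using finite_O by (simp add: normal_form_O if_distrib[of "\<lambda>x. x * _"] cong: if_cong)
    next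
      case False
      then obtain \<alpha> \<eta> where d: "\<alpha> \<in> H" "\<eta> \<in> T \<alpha>" "t = \<eta> + \<alpha>" "cofactor t = \<eta>"
        by (rule cone_cases)
      have IH: "normal_form c (\<epsilon> + (\<eta> + \<sigma>)) \<rho> \<asymp>
          (\<Sum>\<tau>\<in>\<O>. normal_form c (\<eta> + \<sigma>) \<tau> * normal_form c (\<epsilon> + \<tau>) \<rho>)" if "\<sigma> \<in> \<O>" for \<sigma>
      proof (rule less.hyps)
        have low: "level (\<eta> + \<sigma>) \<le> \<omega> \<eta>" using that by (rule level_multiple)
        then show "level (\<eta> + \<sigma>) < level t" using False d(4) by (simp add: level_def)
        show "\<omega> \<epsilon> + \<omega> (cofactor (\<eta> + \<sigma>)) \<le> W" if "\<eta> + \<sigma> \<notin> \<O>"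
          using low that less.prems[OF False] d(4) by (simp add: level_def)
      qed
      have "\<omega> (\<epsilon> + \<eta>) \<le> W" using less.prems[OF False] d(4) by (simp add: add)
      then have "normal_form c (\<epsilon> + t) \<rho> \<asymp> (\<Sum>\<sigma>\<in>\<O>. c \<alpha> \<sigma> * normal_form c (\<epsilon> + (\<eta> + \<sigma>)) \<rho>)"
        using heads[OF _ d(1) rho, of "\<epsilon> + \<eta>"] by (simp add: eqv_def d(3) add.assoc)
      also have "\<dots> \<asymp> (\<Sum>\<sigma>\<in>\<O>. c \<alpha> \<sigma> *
          (\<Sum>\<tau>\<in>\<O>. normal_form c (\<eta> + \<sigma>) \<tau> * normal_form c (\<epsilon> + \<tau>) \<rho>))"
        using IH c d(1) by (intro eqv_sum eqv_mult) auto
      also have "\<dots> = (\<Sum>\<tau>\<in>\<O>. normal_form c t \<tau> * normal_form c (\<epsilon> + \<tau>) \<rho>)"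
        unfolding d(3) normal_form_cone[OF d(1,2)] sum_distrib_left sum_distrib_right
        by (subst sum.swap) (simp add: mult.assoc)
      finally show ?thesis .
    qed
  qed
  then show ?thesis by (simp add: eqv_def)
qed

text \<open>The hypotheses are those of Buchberger's criterion restricted to the products of a head term with
  one non-multiplicative variable. The proof is an induction on the weight of the multiplier
  \<open>\<delta>\<close> of a head term \<open>\<alpha>\<close>. A non-multiplicative \<open>\<delta>\<close> is written as \<open>\<delta>' + tvar k\<close>; the product
  \<open>tvar k + \<alpha>\<close> lies in another cone with a lighter multiplier, and the criterion exchanges its
  normal form for the multiplied tail of \<open>\<alpha>\<close>. Every other multiplier that occurs is lighter than
  \<open>\<delta>\<close>.\<close>

theorem normal_form_multiple:
  assumes "congruence A I" and c: "\<And>\<alpha> \<sigma>. \<alpha> \<in> H \<Longrightarrow> \<sigma> \<in> \<O> \<Longrightarrow> c \<alpha> \<sigma> \<in> A"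
    and add: "\<And>s t. \<omega> (s + t) = \<omega> s + \<omega> t"
    and factor: "\<And>\<alpha> \<delta>. \<alpha> \<in> H \<Longrightarrow> \<delta> \<notin> T \<alpha> \<Longrightarrow> \<exists>k \<delta>'. \<delta> = \<delta>' + tvar k \<and> tvar k \<notin> T \<alpha>"
    and drop: "\<And>\<alpha> k \<beta> \<theta>. \<alpha> \<in> H \<Longrightarrow> tvar k \<notin> T \<alpha> \<Longrightarrow> \<beta> \<in> H \<Longrightarrow> \<theta> \<in> T \<beta> \<Longrightarrow>
      tvar k + \<alpha> = \<theta> + \<beta> \<Longrightarrow> \<omega> \<theta> < \<omega> (tvar k)"
    and s_pair: "\<And>\<alpha> k \<beta> \<theta> \<rho>. \<alpha> \<in> H \<Longrightarrow> tvar k \<notin> T \<alpha> \<Longrightarrow> \<beta> \<in> H \<Longrightarrow> \<theta> \<in> T \<beta> \<Longrightarrow>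
      tvar k + \<alpha> = \<theta> + \<beta> \<Longrightarrow> \<rho> \<in> \<O> \<Longrightarrow>
      (\<Sum>\<sigma>\<in>\<O>. c \<beta> \<sigma> * normal_form c (\<theta> + \<sigma>) \<rho>)
        - (\<Sum>\<sigma>\<in>\<O>. c \<alpha> \<sigma> * normal_form c (tvar k + \<sigma>) \<rho>) \<in> I"
    and rho: "\<rho> \<in> \<O>"
  shows "normal_form c (\<epsilon> + t) \<rho> - (\<Sum>\<sigma>\<in>\<O>. normal_form c t \<sigma> * normal_form c (\<epsilon> + \<sigma>) \<rho>) \<in> I"
proof -
  interpret congruence A I by fact
  have nf_closed: "normal_form c t \<rho> \<in> A" for t \<rho>
    using subring_of_type_axioms c by (rule normal_form_closed)
  have heads: "normal_form c (\<delta> + \<alpha>) \<rho> \<asymp> (\<Sum>\<sigma>\<in>\<O>. c \<alpha> \<sigma> * normal_form c (\<delta> + \<sigma>) \<rho>)"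
    if "\<alpha> \<in> H" "\<rho> \<in> \<O>" for \<delta> \<alpha> \<rho>
    using that
  proof (induction "\<omega> \<delta>" arbitrary: \<delta> \<alpha> \<rho> rule: less_induct)
    case less
    note a = less.prems(1)
    show ?case
    proof (cases "\<delta> \<in> T \<alpha>")
      case True
      then show ?thesis by (simp add: normal_form_cone[OF a])
    next
      case False
      from factor[OF a this] obtain k \<delta>' where k: "\<delta> = \<delta>' + tvar k" "tvar k \<notin> T \<alpha>" by blast
      have "tvar k + \<alpha> \<notin> \<O>" using a by (rule outside)
      then obtain \<beta> \<theta> where b: "\<beta> \<in> H" "\<theta> \<in> T \<beta>" "tvar k + \<alpha> = \<theta> + \<beta>" "cofactor (tvar k + \<alpha>) = \<theta>"
        by (rule cone_cases)
      have pos: "\<omega> \<delta> > 0" using drop[OF a k(2) b(1-3)] by (simp add: k(1) add)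
      \<comment> \<open>If the multiplier of \<open>s\<close> is lighter than \<open>tvar k\<close>, only multipliers lighter than
        \<open>\<delta>\<close> occur in \<open>\<delta>' + s\<close>, so the induction hypothesis covers them.\<close>
      have L: "normal_form c (\<delta>' + s) \<rho> \<asymp> (\<Sum>\<sigma>\<in>\<O>. normal_form c s \<sigma> * normal_form c (\<delta>' + \<sigma>) \<rho>)"
        if s: "s \<notin> \<O> \<Longrightarrow> \<omega> (cofactor s) < \<omega> (tvar k)" for s
        unfolding eqv_def
      proof (rule normal_form_multiple_below[where W = "\<omega> \<delta> - 1", OF \<open>congruence A I\<close> c add _ _ less.prems(2)])
        show "\<omega> \<delta>' + \<omega> (cofactor s) \<le> \<omega> \<delta> - 1" if "s \<notin> \<O>"
          using s[OF that] by (simp add: k(1) add)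
      next
        fix \<epsilon> \<beta> \<tau> assume *: "\<omega> \<epsilon> \<le> \<omega> \<delta> - 1" "\<beta> \<in> H" "\<tau> \<in> \<O>"
        show "normal_form c (\<epsilon> + \<beta>) \<tau> - (\<Sum>\<sigma>\<in>\<O>. c \<beta> \<sigma> * normal_form c (\<epsilon> + \<sigma>) \<tau>) \<in> I"
          using less.hyps[OF _ *(2,3), of \<epsilon>] *(1) pos by (simp add: eqv_def)
      qed
      \<comment> \<open>The cone of \<open>\<beta>\<close> gives the normal form of \<open>tvar k + \<alpha>\<close>, and the S-polynomial compares it
        with the multiplied tail of \<open>\<alpha>\<close>.\<close>
      have swap: "normal_form c (tvar k + \<alpha>) \<tau> \<asymp> (\<Sum>\<sigma>\<in>\<O>. c \<alpha> \<sigma> * normal_form c (tvar k + \<sigma>) \<tau>)"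
        if "\<tau> \<in> \<O>" for \<tau>
        using s_pair[OF a k(2) b(1-3) that] by (simp add: eqv_def b(3) normal_form_cone[OF b(1,2)])
      have low: "\<omega> (cofactor (tvar k + \<sigma>)) < \<omega> (tvar k)" if "\<sigma> \<in> \<O>" "tvar k + \<sigma> \<notin> \<O>" for \<sigma>
        using level_multiple[OF that(1), of "tvar k"] that(2) by (simp add: level_def)
      have "normal_form c (\<delta> + \<alpha>) \<rho> \<asymp>
          (\<Sum>\<tau>\<in>\<O>. normal_form c (tvar k + \<alpha>) \<tau> * normal_form c (\<delta>' + \<tau>) \<rho>)"
        using L[of "tvar k + \<alpha>"] drop[OF a k(2) b(1-3)] by (simp add: k(1) b(4) add.assoc)
      also have "\<dots> \<asymp> (\<Sum>\<tau>\<in>\<O>. (\<Sum>\<sigma>\<in>\<O>. c \<alpha> \<sigma> * normal_form c (tvar k + \<sigma>) \<tau>) * normal_form c (\<delta>' + \<tau>) \<rho>)"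
        using swap by (intro eqv_sum eqv_mult_right nf_closed)
      also have "\<dots> = (\<Sum>\<sigma>\<in>\<O>. c \<alpha> \<sigma> * (\<Sum>\<tau>\<in>\<O>. normal_form c (tvar k + \<sigma>) \<tau> * normal_form c (\<delta>' + \<tau>) \<rho>))"
        unfolding sum_distrib_left sum_distrib_right by (subst sum.swap) (simp add: mult.assoc)
      also have "\<dots> \<asymp> (\<Sum>\<sigma>\<in>\<O>. c \<alpha> \<sigma> * normal_form c (\<delta>' + (tvar k + \<sigma>)) \<rho>)"
        using low c a by (intro eqv_sum eqv_mult eqv_sym[OF L]) auto
      finally show ?thesis by (simp add: k(1) add.assoc)
    qed
  qed
  show ?thesis
    by (rule normal_form_multiple_below[where W = "\<omega> \<epsilon> + \<omega> (cofactor t)", OF \<open>congruence A I\<close> c add])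
      (use heads rho in \<open>auto simp: eqv_def\<close>)
qed

text \<open>With coefficients \<open>N \<alpha> \<sigma>\<close> in place of the parameters, any normal form of \<open>t\<close> is congruent to
  \<open>N t\<close>, because \<open>N\<close> satisfies the recursion of \<open>normal_form\<close> modulo the ideal. This holds for
  every choice of cones, so \<open>N\<close> may come from another decomposition than the one that reduces the
  S-polynomials.\<close>

theorem substitute_reduced_s_poly:
  fixes N :: "'x pterm \<Rightarrow> 'x pterm \<Rightarrow> ('x, 'k::comm_ring_1) param_poly"
  assumes "congruence A I" and N_closed: "\<And>t \<rho>. N t \<rho> \<in> A"
    and N_O: "\<And>t \<rho>. t \<in> \<O> \<Longrightarrow> N t \<rho> = (if t = \<rho> then 1 else 0)"
    and multiple: "\<And>\<epsilon> t \<rho>. \<rho> \<in> \<O> \<Longrightarrow> N (\<epsilon> + t) \<rho> - (\<Sum>\<sigma>\<in>\<O>. N t \<sigma> * N (\<epsilon> + \<sigma>) \<rho>) \<in> I"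
  shows "substitute (\<lambda>(\<tau>, \<sigma>). N \<tau> \<sigma>)
    (Poly_Mapping.lookup (reduced_form \<O> H T (s_poly \<O> \<alpha> \<beta>)) \<rho>) \<in> I"
proof -
  interpret congruence A I by fact
  define e where "e = (\<lambda>(\<tau>, \<sigma>). N \<tau> \<sigma>)"
  have param: "substitute e (param \<tau> \<sigma>) = N \<tau> \<sigma>" for \<tau> \<sigma>
    by (simp add: param_def substitute_single monomial_value_single[unfolded One_nat_def] e_def)
  have nf: "substitute e (normal_form param t \<rho>) \<asymp> N t \<rho>" if rho: "\<rho> \<in> \<O>" for t \<rho>
  proof (induction "level t" arbitrary: t rule: less_induct)
    case less
    show ?case
    proof (cases "t \<in> \<O>")
      case True
      then show ?thesis by (simp add: normal_form_O N_O)
    next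
      case False
      then obtain \<alpha> \<eta> where d: "\<alpha> \<in> H" "\<eta> \<in> T \<alpha>" "t = \<eta> + \<alpha>" "cofactor t = \<eta>"
        by (rule cone_cases)
      have "level (\<eta> + \<sigma>) < level t" if "\<sigma> \<in> \<O>" for \<sigma>
        using level_multiple[OF that, of \<eta>] False d(4) by (simp add: level_def)
      then have "substitute e (normal_form param t \<rho>) \<asymp> (\<Sum>\<sigma>\<in>\<O>. N \<alpha> \<sigma> * N (\<eta> + \<sigma>) \<rho>)"
        unfolding d(3) normal_form_cone[OF d(1,2)] substitute_sum substitute_mult param
        using less.hyps by (intro eqv_sum eqv_mult N_closed) (auto simp: d(3))
      also have "\<dots> \<asymp> N t \<rho>"
        using eqv_sym multiple[OF rho] unfolding d(3) eqv_def by blast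
      finally show ?thesis .
    qed
  qed
  define g where "g = (Poly_Mapping.lookup (reduced_form \<O> H T (s_poly \<O> \<alpha> \<beta>)) \<rho> :: ('x, 'k) param_poly)"
  from g_def have "substitute e g \<in> I"
  proof (cases rule: reduced_s_poly_cases)
    case 1
    then show ?thesis by (simp add: I_zero)
  next
    case (2 u v)
    have red: "(\<Sum>\<sigma>\<in>\<O>. N \<gamma> \<sigma> * substitute e (normal_form param (w + \<sigma>) \<rho>)) \<asymp> N (w + \<gamma>) \<rho>" for \<gamma> w
    proof -
      have "(\<Sum>\<sigma>\<in>\<O>. N \<gamma> \<sigma> * substitute e (normal_form param (w + \<sigma>) \<rho>)) \<asymp>
          (\<Sum>\<sigma>\<in>\<O>. N \<gamma> \<sigma> * N (w + \<sigma>) \<rho>)"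
        by (intro eqv_sum eqv_mult N_closed nf 2(1))
      also have "\<dots> \<asymp> N (w + \<gamma>) \<rho>"
        using eqv_sym multiple[OF 2(1)] unfolding eqv_def by blast
      finally show ?thesis .
    qed
    \<comment> \<open>Both sums are congruent to the coordinate of the same term, the least common multiple.\<close>
    from eqv_diff[OF red[of \<beta> v] red[of \<alpha> u]] show ?thesis
      by (simp add: 2(2,3) eqv_def substitute_diff substitute_sum substitute_mult param)
  qed
  then show ?thesis by (simp add: e_def g_def)
qed

end

context finite_order_ideal
begin

text \<open>If \<open>tvar k + \<alpha>\<close> is a non-multiplicative multiple and lies in the cone of \<open>\<beta>\<close>, then
  \<open>(\<alpha>, \<beta>)\<close> is a non-multiplicative couple and \<open>tvar k + \<alpha>\<close> is the least common multiple. So the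
  reduced S-polynomials of these couples are all that the criterion asks for.\<close>

lemma pommaret_normal_form_multiple:
  fixes J :: "('x, 'k::comm_ring_1) param_poly set"
  assumes J: "congruence A J"
    and coeffs: "\<And>\<alpha> \<sigma>. \<alpha> \<in> pommaret_basis \<O> \<Longrightarrow> \<sigma> \<in> \<O> \<Longrightarrow> param \<alpha> \<sigma> \<in> A"
    and gens: "\<And>\<alpha> \<beta> \<rho>. \<alpha> \<in> pommaret_basis \<O> \<Longrightarrow> \<beta> \<in> pommaret_basis \<O> \<Longrightarrow>
      nonmultiplicative_couple \<alpha> \<beta> \<Longrightarrow>
      Poly_Mapping.lookup (reduced_form \<O> (pommaret_basis \<O>) pommaret_mult (s_poly \<O> \<alpha> \<beta>)) \<rho> \<in> J"
    and rho: "\<rho> \<in> \<O>"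
  defines "N \<equiv> head_decomposition.normal_form \<O> (pommaret_basis \<O>) pommaret_mult param"
  shows "N (\<epsilon> + t) \<rho> - (\<Sum>\<sigma>\<in>\<O>. N t \<sigma> * N (\<epsilon> + \<sigma>) \<rho>) \<in> J"
proof -
  interpret P: head_decomposition \<O> "pommaret_basis \<O>" pommaret_mult "lex_weight bound"
    by (rule pommaret_head_decomposition)
  show ?thesis
    unfolding N_def
  proof (rule P.normal_form_multiple[OF J coeffs lex_weight_add _ _ _ rho])
    fix \<alpha> \<delta> :: "'x pterm" assume "\<delta> \<notin> pommaret_mult \<alpha>"
    then obtain k where k: "k \<in> Poly_Mapping.keys \<delta>" "\<not> k \<le> tmin \<alpha>" by (auto simp: pommaret_mult_def)
    then have "\<delta> = (\<delta> - tvar k) + tvar k" "tvar k \<notin> pommaret_mult \<alpha>"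
      using tvar_add_minus[OF k(1)] by (simp_all add: add.commute pommaret_mult_def tvar_def)
    then show "\<exists>k \<delta>'. \<delta> = \<delta>' + tvar k \<and> tvar k \<notin> pommaret_mult \<alpha>" by blast
  next
    fix \<alpha> k \<beta> \<theta> \<rho>
    assume *: "\<alpha> \<in> pommaret_basis \<O>" "tvar k \<notin> pommaret_mult \<alpha>" "\<beta> \<in> pommaret_basis \<O>"
      "\<theta> \<in> pommaret_mult \<beta>" "tvar k + \<alpha> = \<theta> + \<beta>"
    note lcm = pommaret_nonmultiplicative[OF *(1,3,4,2,5)]
    show "lex_weight bound \<theta> < lex_weight bound (tvar k)" by (rule lcm(1))
    assume "\<rho> \<in> \<O>"
    have "nonmultiplicative_couple \<alpha> \<beta>"
      unfolding nonmultiplicative_couple_def using * by blast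
    then have "Poly_Mapping.lookup (reduced_form \<O> (pommaret_basis \<O>) pommaret_mult (s_poly \<O> \<alpha> \<beta>)) \<rho> \<in> J"
      using *(1,3) by (intro gens)
    then show "(\<Sum>\<sigma>\<in>\<O>. param \<beta> \<sigma> * P.normal_form param (\<theta> + \<sigma>) \<rho>)
        - (\<Sum>\<sigma>\<in>\<O>. param \<alpha> \<sigma> * P.normal_form param (tvar k + \<sigma>) \<rho>) \<in> J"
      by (simp only: P.lookup_reduced_s_poly[OF \<open>\<rho> \<in> \<O>\<close> *(5) lcm(2)])
  qed
qed

end

section \<open>Commuting multiplication operators\<close>

context finite_order_ideal
begin

definition border_coord :: "('x pterm \<Rightarrow> 'x pterm \<Rightarrow> 'a::comm_ring_1) \<Rightarrow> 'x pterm \<Rightarrow> 'x pterm \<Rightarrow> 'a" where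
  "border_coord c t \<rho> = (if t \<in> \<O> then (if t = \<rho> then 1 else 0) else c t \<rho>)"

text \<open>The formal multiplication operator of the variable \<open>x\<close> on the free module with basis \<open>\<O>\<close>, applied
  to a coordinate vector \<open>v\<close>.\<close>

definition var_mult :: "('x pterm \<Rightarrow> 'x pterm \<Rightarrow> 'a::comm_ring_1) \<Rightarrow> 'x \<Rightarrow> ('x pterm \<Rightarrow> 'a) \<Rightarrow> 'x pterm \<Rightarrow> 'a" where
  "var_mult c x v \<rho> = (\<Sum>\<sigma>\<in>\<O>. v \<sigma> * border_coord c (tvar x + \<sigma>) \<rho>)"

text \<open>The operators of the variables of \<open>t\<close> are applied to the basis vector \<open>1\<close>, the one of the smallest
  variable last. Fixing an order gives coordinates of \<open>t\<close> before the operators are known to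
  commute.\<close>

function power_coord :: "('x pterm \<Rightarrow> 'x pterm \<Rightarrow> 'a::comm_ring_1) \<Rightarrow> 'x pterm \<Rightarrow> 'x pterm \<Rightarrow> 'a" where
  "power_coord c t = (if t = 0 then (\<lambda>\<rho>. if \<rho> = 0 then 1 else 0)
    else var_mult c (tmin t) (power_coord c (t - tvar (tmin t))))"
  by auto
termination
proof (relation "measure (\<lambda>(c, t). tdeg t)", goal_cases)
  case (2 c t)
  have "tdeg t = Suc (tdeg (t - tvar (tmin t)))"
    using arg_cong[OF tvar_add_minus[OF tmin_in_keys[OF 2]], of tdeg] by (simp add: tdeg_add tdeg_tvar)
  then show ?case by simp
qed simp

declare power_coord.simps [simp del]

lemma var_mult_O: "\<tau> \<in> \<O> \<Longrightarrow> var_mult c x (\<lambda>\<sigma>. if \<tau> = \<sigma> then 1 else 0) \<rho> = border_coord c (tvar x + \<tau>) \<rho>"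
  using finite_O by (simp add: var_mult_def if_distrib[of "\<lambda>x. x * _"] cong: if_cong)

lemma var_mult_border_coord_O:
  "\<tau> \<in> \<O> \<Longrightarrow> var_mult c x (border_coord c \<tau>) \<rho> = border_coord c (tvar x + \<tau>) \<rho>"
  using var_mult_O[of \<tau> c x \<rho>] by (simp add: border_coord_def[of c \<tau>, abs_def])

end

text \<open>Commutation is assumed on basis vectors only and extends to all vectors with entries in \<open>A\<close>.\<close>

locale commuting_var_mults = finite_order_ideal \<O> + congruence A I
  for \<O> :: "'x::{finite,linorder} pterm set" and A I :: "'a::comm_ring_1 set" +
  fixes c :: "'x pterm \<Rightarrow> 'x pterm \<Rightarrow> 'a"
  assumes coeff_closed: "\<alpha> \<in> border \<O> \<Longrightarrow> \<sigma> \<in> \<O> \<Longrightarrow> c \<alpha> \<sigma> \<in> A"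
    and commute: "\<sigma> \<in> \<O> \<Longrightarrow> \<rho> \<in> \<O> \<Longrightarrow>
      var_mult c i (border_coord c (tvar j + \<sigma>)) \<rho> \<asymp> var_mult c j (border_coord c (tvar i + \<sigma>)) \<rho>"
begin

lemma border_coord_closed: "\<sigma> \<in> \<O> \<Longrightarrow> \<rho> \<in> \<O> \<Longrightarrow> border_coord c (tvar x + \<sigma>) \<rho> \<in> A"
  using coeff_closed tvar_O by (auto simp: border_coord_def closed)

lemma var_mult_closed: "(\<And>\<sigma>. \<sigma> \<in> \<O> \<Longrightarrow> v \<sigma> \<in> A) \<Longrightarrow> \<rho> \<in> \<O> \<Longrightarrow> var_mult c x v \<rho> \<in> A"
  unfolding var_mult_def by (intro sum_closed mult_closed border_coord_closed)

lemma var_mult_eqv: "(\<And>\<sigma>. \<sigma> \<in> \<O> \<Longrightarrow> v \<sigma> \<asymp> w \<sigma>) \<Longrightarrow> \<rho> \<in> \<O> \<Longrightarrow> var_mult c x v \<rho> \<asymp> var_mult c x w \<rho>"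
  unfolding var_mult_def by (intro eqv_sum eqv_mult_right border_coord_closed)

lemma var_mult_var_mult: "var_mult c i (var_mult c j v) \<rho> = (\<Sum>\<tau>\<in>\<O>. v \<tau> * var_mult c i (border_coord c (tvar j + \<tau>)) \<rho>)"
  unfolding var_mult_def sum_distrib_left sum_distrib_right
  by (subst sum.swap) (simp add: mult.assoc)

lemma var_mult_commute:
  "(\<And>\<sigma>. \<sigma> \<in> \<O> \<Longrightarrow> v \<sigma> \<in> A) \<Longrightarrow> \<rho> \<in> \<O> \<Longrightarrow> var_mult c i (var_mult c j v) \<rho> \<asymp> var_mult c j (var_mult c i v) \<rho>"
  unfolding var_mult_var_mult by (intro eqv_sum eqv_mult commute)

lemma power_coord_closed: "\<rho> \<in> \<O> \<Longrightarrow> power_coord c t \<rho> \<in> A"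
proof (induction "tdeg t" arbitrary: t \<rho> rule: less_induct)
  case less
  show ?case
  proof (cases "t = 0")
    case True
    then show ?thesis by (simp add: power_coord.simps closed)
  next
    case False
    define s where "s = t - tvar (tmin t)"
    have "tdeg t = Suc (tdeg s)" unfolding s_def
      using arg_cong[OF tvar_add_minus[OF tmin_in_keys[OF False]], of tdeg] by (simp add: tdeg_add tdeg_tvar)
    then show ?thesis
      using less by (subst power_coord.simps) (simp add: False var_mult_closed flip: s_def)
  qed
qed

text \<open>If \<open>x\<close> is not the smallest variable \<open>k\<close> of the product, then \<open>k\<close> divides \<open>t\<close>, and the operator of
  \<open>x\<close> is moved past that of \<open>k\<close>; the induction hypothesis is used for \<open>t\<close> divided by \<open>k\<close>, once with
  \<open>x\<close> and once with \<open>k\<close>.\<close>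

lemma power_coord_tvar: "\<rho> \<in> \<O> \<Longrightarrow> power_coord c (tvar x + t) \<rho> \<asymp> var_mult c x (power_coord c t) \<rho>"
proof (induction "tdeg t" arbitrary: t x \<rho> rule: less_induct)
  case less
  define k where "k = tmin (tvar x + t)"
  have "x \<in> Poly_Mapping.keys (tvar x + t)" by (simp add: in_keys_iff lookup_add lookup_tvar)
  then have nz: "tvar x + t \<noteq> 0" by force
  have step: "power_coord c (tvar x + t) = var_mult c k (power_coord c (tvar x + t - tvar k))"
    by (subst power_coord.simps) (simp add: nz k_def)
  show ?case
  proof (cases "k = x")
    case True
    then show ?thesis unfolding step by simp
  next
    case False
    have "k \<in> Poly_Mapping.keys (tvar x + t)" unfolding k_def by (rule tmin_in_keys[OF nz])
    then have "k \<in> Poly_Mapping.keys t" using False by (simp add: in_keys_iff lookup_add lookup_tvar)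
    then obtain s where s: "t = tvar k + s" using tvar_add_minus by metis
    then have deg: "tdeg s < tdeg t" by (simp add: tdeg_add tdeg_tvar)
    have "tvar x + t - tvar k = tvar x + s"
      unfolding s by (metis add.left_commute add_diff_cancel_left')
    then have "power_coord c (tvar x + t) \<rho> = var_mult c k (power_coord c (tvar x + s)) \<rho>"
      by (simp add: step)
    also have "\<dots> \<asymp> var_mult c k (var_mult c x (power_coord c s)) \<rho>"
      using less.hyps[OF deg] less.prems by (intro var_mult_eqv)
    also have "\<dots> \<asymp> var_mult c x (var_mult c k (power_coord c s)) \<rho>"
      using less.prems by (intro var_mult_commute power_coord_closed)
    also have "\<dots> \<asymp> var_mult c x (power_coord c t) \<rho>"
      unfolding s using less.prems by (intro var_mult_eqv eqv_sym[OF less.hyps[OF deg]])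
    finally show ?thesis .
  qed
qed

lemma power_coord_O: "\<tau> \<in> \<O> \<Longrightarrow> \<rho> \<in> \<O> \<Longrightarrow> power_coord c \<tau> \<rho> \<asymp> (if \<tau> = \<rho> then 1 else 0)"
proof (induction \<tau> arbitrary: \<rho> rule: term_induct)
  case zero
  then show ?case by (auto simp: power_coord.simps)
next
  case (tvar x \<tau>)
  then have "\<tau> \<in> \<O>" using factor_closed by blast
  have "power_coord c (tvar x + \<tau>) \<rho> \<asymp> var_mult c x (power_coord c \<tau>) \<rho>"
    using tvar(3) by (rule power_coord_tvar)
  also have "\<dots> \<asymp> var_mult c x (\<lambda>\<sigma>. if \<tau> = \<sigma> then 1 else 0) \<rho>"
    using tvar \<open>\<tau> \<in> \<O>\<close> by (intro var_mult_eqv) auto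
  finally show ?case using tvar(2) by (simp add: var_mult_O[OF \<open>\<tau> \<in> \<O>\<close>] border_coord_def)
qed

lemma power_coord_border: "\<alpha> \<in> border \<O> \<Longrightarrow> \<rho> \<in> \<O> \<Longrightarrow> power_coord c \<alpha> \<rho> \<asymp> c \<alpha> \<rho>"
proof -
  assume a: "\<alpha> \<in> border \<O>" and rho: "\<rho> \<in> \<O>"
  then obtain x \<tau> where t: "\<tau> \<in> \<O>" "\<alpha> = tvar x + \<tau>" "\<alpha> \<notin> \<O>" by (auto simp: border_iff)
  have "power_coord c \<alpha> \<rho> \<asymp> var_mult c x (power_coord c \<tau>) \<rho>"
    unfolding t(2) using rho by (rule power_coord_tvar)
  also have "\<dots> \<asymp> var_mult c x (\<lambda>\<sigma>. if \<tau> = \<sigma> then 1 else 0) \<rho>"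
    using rho t(1) by (intro var_mult_eqv power_coord_O)
  finally show ?thesis using t by (simp add: var_mult_O border_coord_def)
qed

text \<open>The coordinates of a marked polynomial vanish by \<open>power_coord_O\<close> and \<open>power_coord_border\<close>, and
  multiplying it by a variable applies a linear operator to them.\<close>

lemma power_coord_multiple:
  "\<alpha> \<in> border \<O> \<Longrightarrow> \<rho> \<in> \<O> \<Longrightarrow>
    (\<Sum>\<sigma>\<in>\<O>. c \<alpha> \<sigma> * power_coord c (\<eta> + \<sigma>) \<rho>) \<asymp> power_coord c (\<eta> + \<alpha>) \<rho>"
proof (induction \<eta> arbitrary: \<rho> rule: term_induct)
  case zero
  have "(\<Sum>\<sigma>\<in>\<O>. c \<alpha> \<sigma> * power_coord c \<sigma> \<rho>) \<asymp> (\<Sum>\<sigma>\<in>\<O>. c \<alpha> \<sigma> * (if \<sigma> = \<rho> then 1 else 0))"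
    using zero by (intro eqv_sum eqv_mult coeff_closed power_coord_O)
  also have "\<dots> = c \<alpha> \<rho>"
    using finite_O zero by (simp add: if_distrib[of "\<lambda>x. _ * x"] cong: if_cong)
  also have "\<dots> \<asymp> power_coord c \<alpha> \<rho>" using power_coord_border[OF zero] by (rule eqv_sym)
  finally show ?case by simp
next
  case (tvar x \<eta>)
  have "(\<Sum>\<sigma>\<in>\<O>. c \<alpha> \<sigma> * power_coord c (tvar x + \<eta> + \<sigma>) \<rho>) \<asymp>
      (\<Sum>\<sigma>\<in>\<O>. c \<alpha> \<sigma> * var_mult c x (power_coord c (\<eta> + \<sigma>)) \<rho>)"
    unfolding add.assoc using tvar by (intro eqv_sum eqv_mult coeff_closed power_coord_tvar)
  also have "\<dots> = var_mult c x (\<lambda>\<tau>. \<Sum>\<sigma>\<in>\<O>. c \<alpha> \<sigma> * power_coord c (\<eta> + \<sigma>) \<tau>) \<rho>"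
    unfolding var_mult_def sum_distrib_left sum_distrib_right by (subst sum.swap) (simp add: mult.assoc)
  also have "\<dots> \<asymp> var_mult c x (power_coord c (\<eta> + \<alpha>)) \<rho>"
    using tvar by (intro var_mult_eqv)
  also have "\<dots> \<asymp> power_coord c (tvar x + \<eta> + \<alpha>) \<rho>"
    unfolding add.assoc using tvar by (intro eqv_sym[OF power_coord_tvar])
  finally show ?case .
qed

text \<open>Both families agree on \<open>\<O>\<close>, and by \<open>power_coord_multiple\<close> the coordinates satisfy the recursion of
  \<open>normal_form\<close> for any head terms in the border, whatever the cones are.\<close>

theorem normal_form_power_coord:
  assumes "head_decomposition \<O> H T \<omega>" and H: "H \<subseteq> border \<O>" and rho: "\<rho> \<in> \<O>"
  shows "head_decomposition.normal_form \<O> H T c t \<rho> \<asymp> power_coord c t \<rho>"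
proof -
  interpret head_decomposition \<O> H T \<omega> by fact
  show ?thesis
  proof (induction "level t" arbitrary: t rule: less_induct)
    case less
    show ?case
    proof (cases "t \<in> \<O>")
      case True
      then show ?thesis using eqv_sym[OF power_coord_O[OF True rho]] by (simp add: normal_form_O)
    next
      case False
      then obtain \<alpha> \<eta> where d: "\<alpha> \<in> H" "\<eta> \<in> T \<alpha>" "t = \<eta> + \<alpha>" "cofactor t = \<eta>"
        by (rule cone_cases)
      then have a: "\<alpha> \<in> border \<O>" using H by blast
      have "level (\<eta> + \<sigma>) < level t" if "\<sigma> \<in> \<O>" for \<sigma>
        using level_multiple[OF that, of \<eta>] False d(4) by (simp add: level_def)
      then have "normal_form c t \<rho> \<asymp> (\<Sum>\<sigma>\<in>\<O>. c \<alpha> \<sigma> * power_coord c (\<eta> + \<sigma>) \<rho>)"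
        unfolding d(3) normal_form_cone[OF d(1,2)] using a less.hyps
        by (intro eqv_sum eqv_mult coeff_closed) (auto simp: d(3))
      also have "\<dots> \<asymp> power_coord c t \<rho>"
        unfolding d(3) using a rho by (rule power_coord_multiple)
      finally show ?thesis .
    qed
  qed
qed

end

context finite_order_ideal
begin

text \<open>If both \<open>tvar i + \<sigma>\<close> and \<open>tvar j + \<sigma>\<close> belong to \<open>\<O>\<close>, the two operators commute on \<open>\<sigma>\<close> without
  any condition. If one of them is a border term \<open>\<alpha>\<close>, the product of \<open>\<alpha>\<close> with the other variable is
  a border term as well, and the two neighbours differ by one variable. If both are border terms,
  they are neighbours with a common multiple one degree above. In either case the commutator on
  \<open>\<sigma>\<close> is, up to sign, the reduced S-polynomial of the couple.\<close>

lemma neighbours_commute: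
  fixes I :: "('x, 'k::comm_ring_1) param_poly set"
  assumes enum: "border_enumeration \<O> \<tau>s" and "congruence A I"
    and gens: "\<And>\<alpha> \<beta> \<rho>. \<alpha> \<in> border \<O> \<Longrightarrow> \<beta> \<in> border \<O> \<Longrightarrow> neighbour_couple \<alpha> \<beta> \<Longrightarrow>
      Poly_Mapping.lookup (reduced_form \<O> (border \<O>) (border_mult \<tau>s) (s_poly \<O> \<alpha> \<beta>)) \<rho> \<in> I"
    and sr: "\<sigma> \<in> \<O>" "\<rho> \<in> \<O>"
  shows "var_mult param i (border_coord param (tvar j + \<sigma>)) \<rho>
    - var_mult param j (border_coord param (tvar i + \<sigma>)) \<rho> \<in> I"
proof -
  interpret congruence A I by fact
  interpret B: head_decomposition \<O> "border \<O>" "border_mult \<tau>s" tdeg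
    using enum by (rule border_head_decomposition)
  have nf: "B.normal_form param (tvar x + \<tau>) \<rho> = (border_coord param (tvar x + \<tau>) \<rho> :: ('x, 'k) param_poly)"
    if "\<tau> \<in> \<O>" for x \<tau>
    using that sr(2) tvar_O by (auto simp: border_coord_def B.normal_form_O B.normal_form_head)
  have var_mult_nf: "var_mult param x (border_coord param \<alpha>) \<rho> =
      (\<Sum>\<tau>\<in>\<O>. param \<alpha> \<tau> * (B.normal_form param (tvar x + \<tau>) \<rho> :: ('x, 'k) param_poly))"
    if "\<alpha> \<in> border \<O>" for \<alpha> x
    using that unfolding var_mult_def by (intro sum.cong) (simp_all add: nf border_coord_def border_iff)
  have next_door: "var_mult param i (border_coord param (tvar j + \<sigma>)) \<rho> \<asymp>
      (var_mult param j (border_coord param (tvar i + \<sigma>)) \<rho> :: ('x, 'k) param_poly)"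
    if i: "tvar i + \<sigma> \<in> \<O>" and j: "tvar j + \<sigma> \<notin> \<O>" for i j
  proof -
    define \<alpha> where "\<alpha> = tvar j + \<sigma>"
    have a: "\<alpha> \<in> border \<O>" unfolding \<alpha>_def using tvar_O sr(1) j by blast
    have comm: "tvar j + (tvar i + \<sigma>) = tvar i + \<alpha>" by (simp add: \<alpha>_def add.left_commute)
    have "tvar i + \<alpha> \<notin> \<O>" using factor_closed a by (auto simp: border_iff)
    then have b: "tvar i + \<alpha> \<in> border \<O>" using tvar_O[OF i, of j] by (simp add: comm)
    have "neighbour_couple (tvar i + \<alpha>) \<alpha>" by (auto simp: neighbour_couple_def)
    from gens[OF b a this, of \<rho>]
    have "(\<Sum>\<tau>\<in>\<O>. param \<alpha> \<tau> * B.normal_form param (tvar i + \<tau>) \<rho>)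
        - (\<Sum>\<tau>\<in>\<O>. (param (tvar i + \<alpha>) \<tau> :: ('x, 'k) param_poly) * B.normal_form param (0 + \<tau>) \<rho>) \<in> I"
      by (subst (asm) B.lookup_reduced_s_poly[OF sr(2), where u = 0 and v = "tvar i"])
        (simp_all add: tlcm_tvar_left)
    \<comment> \<open>The tail of the larger neighbour is not multiplied, so it is reduced already.\<close>
    moreover have "(\<Sum>\<tau>\<in>\<O>. (param (tvar i + \<alpha>) \<tau> :: ('x, 'k) param_poly) * B.normal_form param (0 + \<tau>) \<rho>)
        = param (tvar i + \<alpha>) \<rho>"
      using finite_O sr(2)
      by (simp add: B.normal_form_O if_distrib[of "\<lambda>x. _ * x"] cong: if_cong sum.cong)
    ultimately have "var_mult param i (border_coord param \<alpha>) \<rho> \<asymp> (param (tvar i + \<alpha>) \<rho> :: ('x, 'k) param_poly)"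
      by (simp add: var_mult_nf[OF a] eqv_def)
    also have "param (tvar i + \<alpha>) \<rho> = var_mult param j (border_coord param (tvar i + \<sigma>)) \<rho>"
      using b by (simp add: var_mult_border_coord_O[OF i] comm border_coord_def border_iff)
    finally show ?thesis by (simp add: \<alpha>_def)
  qed
  have "var_mult param i (border_coord param (tvar j + \<sigma>)) \<rho> \<asymp>
      (var_mult param j (border_coord param (tvar i + \<sigma>)) \<rho> :: ('x, 'k) param_poly)"
  proof (cases "i = j")
    case True
    then show ?thesis by simp
  next
    case False
    consider "tvar i + \<sigma> \<in> \<O>" "tvar j + \<sigma> \<in> \<O>" | "tvar i + \<sigma> \<in> \<O>" "tvar j + \<sigma> \<notin> \<O>"
      | "tvar i + \<sigma> \<notin> \<O>" "tvar j + \<sigma> \<in> \<O>" | "tvar i + \<sigma> \<notin> \<O>" "tvar j + \<sigma> \<notin> \<O>" by blast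
    then show ?thesis
    proof cases
      case 1
      then show ?thesis by (simp add: var_mult_border_coord_O add.left_commute)
    next
      case 2
      then show ?thesis by (rule next_door)
    next
      case 3
      then show ?thesis by (intro eqv_sym[OF next_door])
    next
      case 4
      then have a: "tvar i + \<sigma> \<in> border \<O>" and b: "tvar j + \<sigma> \<in> border \<O>" using sr(1) tvar_O by blast+
      have "neighbour_couple (tvar i + \<sigma>) (tvar j + \<sigma>)"
        unfolding neighbour_couple_def by (metis add.left_commute)
      from gens[OF a b this, of \<rho>] show ?thesis
        using False
        by (subst (asm) B.lookup_reduced_s_poly[OF sr(2), where u = "tvar j" and v = "tvar i"])
          (simp_all add: tlcm_tvar add.left_commute eqv_def var_mult_nf[OF a] var_mult_nf[OF b])
    qed
  qed
  then show ?thesis by (simp add: eqv_def)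
qed

text \<open>Modulo \<open>I\<close>, both multiplied tails have the coordinates of the least common multiple.\<close>

theorem reduced_s_poly_vanishes:
  fixes I :: "('x, 'k::comm_ring_1) param_poly set"
  assumes "commuting_var_mults \<O> A I param"
    and HT: "head_decomposition \<O> H T \<omega>" and H: "H \<subseteq> border \<O>" and ab: "\<alpha> \<in> H" "\<beta> \<in> H"
  shows "Poly_Mapping.lookup (reduced_form \<O> H T (s_poly \<O> \<alpha> \<beta>)) \<rho> \<in> I"
proof -
  interpret commuting_var_mults \<O> A I "param :: 'x pterm \<Rightarrow> 'x pterm \<Rightarrow> ('x, 'k) param_poly" by fact
  interpret head_decomposition \<O> H T \<omega> by fact
  define g where "g = (Poly_Mapping.lookup (reduced_form \<O> H T (s_poly \<O> \<alpha> \<beta>)) \<rho> :: ('x, 'k) param_poly)"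
  from g_def have "g \<in> I"
  proof (cases rule: reduced_s_poly_cases)
    case 1
    then show ?thesis by (simp add: I_zero)
  next
    case (2 u v)
    have red: "(\<Sum>\<sigma>\<in>\<O>. param \<gamma> \<sigma> * normal_form param (w + \<sigma>) \<rho>) \<asymp> power_coord param (w + \<gamma>) \<rho>"
      if "\<gamma> \<in> H" for \<gamma> w
    proof -
      have c: "\<gamma> \<in> border \<O>" using that H by blast
      then have "(\<Sum>\<sigma>\<in>\<O>. param \<gamma> \<sigma> * normal_form param (w + \<sigma>) \<rho>) \<asymp>
          (\<Sum>\<sigma>\<in>\<O>. param \<gamma> \<sigma> * power_coord param (w + \<sigma>) \<rho>)"
        by (intro eqv_sum eqv_mult coeff_closed normal_form_power_coord[OF HT H 2(1)])
      then show ?thesis using power_coord_multiple[OF c 2(1)] by (rule eqv_trans)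
    qed
    from eqv_diff[OF red[OF ab(2), of v] red[OF ab(1), of u]] show ?thesis
      by (simp add: 2(2,3) eqv_def)
  qed
  then show ?thesis by (simp add: g_def)
qed

end

section \<open>The two marked schemes\<close>

text \<open>The substitution \<open>e\<close> is a left inverse of the inclusion of \<open>param_ring W\<close> into \<open>param_ring V\<close>, and
  a right inverse modulo \<open>I\<close>. The latter makes the map from \<open>param_ring W\<close> to the quotient by \<open>I\<close>
  surjective; the former, with \<open>e_I\<close>, shows that its kernel is not larger than \<open>J\<close>.\<close>

theorem param_quotient_schemes_isomorphic:
  fixes I J :: "('x, 'k::comm_ring_1) param_poly set"
  assumes VW: "W \<subseteq> V" and I: "ideal I (param_ring V)" and J: "ideal J (param_ring W)"
    and JI: "J \<subseteq> I"
    and e_closed: "\<And>v. v \<in> V \<Longrightarrow> e v \<in> carrier (param_ring W)"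
    and e_fix: "\<And>v. v \<in> W \<Longrightarrow> e v = pvar v"
    and e_eqv: "\<And>v. v \<in> V \<Longrightarrow> e v - pvar v \<in> I"
    and e_I: "\<And>f. f \<in> I \<Longrightarrow> substitute e f \<in> J"
  shows "isomorphic_over (Spec_quotient (param_ring V) I) (Spec_quotient (param_ring W) J)"
proof -
  let ?R = "param_ring V :: ('x, 'k) param_poly ring" and ?S = "param_ring W :: ('x, 'k) param_poly ring"
  interpret R: cring ?R by (rule cring_param_ring)
  interpret S: cring ?S by (rule cring_param_ring)
  interpret I: ideal I ?R by fact
  interpret J: ideal J ?S by fact
  interpret RI: cring "?R Quot I" by (rule I.quotient_is_cring[OF R.is_cring])
  interpret SJ: cring "?S Quot J" by (rule J.quotient_is_cring[OF S.is_cring])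
  have sub: "carrier ?S \<subseteq> carrier ?R" using VW by (auto simp: param_ring_def)
  define h where "h f = I +>\<^bsub>?R\<^esub> f" for f
  have "h \<in> ring_hom ?R (?R Quot I)" unfolding h_def by (rule I.rcos_ring_hom)
  then have hom: "h \<in> ring_hom ?S (?R Quot I)"
    using sub by (auto simp: ring_hom_def param_ring_def subset_iff)
  interpret h: ring_hom_ring ?S "?R Quot I" h
    using S.ring_axioms RI.ring_axioms hom by (rule ring_hom_ringI2)
  have mem: "h f = h g \<longleftrightarrow> f - g \<in> I" if "f \<in> carrier ?R" "g \<in> carrier ?R" for f g
    unfolding h_def using R.quotient_eq_iff_same_a_r_cos[OF I that] by (simp add: param_ring_minus that)
  have kernel: "a_kernel ?S (?R Quot I) h = J"
  proof
    have memI: "h f = \<zero>\<^bsub>?R Quot I\<^esub> \<longleftrightarrow> f \<in> I" if "f \<in> carrier ?R" for f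
      using that I.rcos_const_imp_mem I.a_rcos_const by (auto simp: h_def FactRing_def)
    show "a_kernel ?S (?R Quot I) h \<subseteq> J"
    proof
      fix f assume "f \<in> a_kernel ?S (?R Quot I) h"
      then have fS: "f \<in> carrier ?S" and "h f = \<zero>\<^bsub>?R Quot I\<^esub>" unfolding a_kernel_def' by blast+
      then have f: "f \<in> carrier ?S" "f \<in> I" using memI[OF subsetD[OF sub fS]] by blast+
      have "substitute e f = f" using f(1) e_fix by (rule substitute_fixes)
      then show "f \<in> J" using e_I[OF f(2)] by simp
    qed
    show "J \<subseteq> a_kernel ?S (?R Quot I) h"
    proof
      fix f assume f: "f \<in> J"
      then have fS: "f \<in> carrier ?S" using J.a_subset by blast
      then have "h f = \<zero>\<^bsub>?R Quot I\<^esub>" using memI[OF subsetD[OF sub fS]] f JI by blast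
      with fS show "f \<in> a_kernel ?S (?R Quot I) h" unfolding a_kernel_def' by blast
    qed
  qed
  have surj: "h ` carrier ?S = carrier (?R Quot I)"
  proof
    show "h ` carrier ?S \<subseteq> carrier (?R Quot I)" by auto
    show "carrier (?R Quot I) \<subseteq> h ` carrier ?S"
    proof
      fix X assume "X \<in> carrier (?R Quot I)"
      then obtain f where f: "f \<in> carrier ?R" "X = h f"
        by (auto simp: FactRing_def A_RCOSETS_def' h_def)
      have s: "substitute e f \<in> carrier ?S" using f(1) e_closed by (rule substitute_closed)
      have "substitute e f - f \<in> I"
        using I f(1) _ e_eqv by (rule substitute_eqv) (use e_closed sub in blast)
      then have "h (substitute e f) = X" using mem[of "substitute e f" f] f s sub by auto
      then show "X \<in> h ` carrier ?S" using s by blast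
    qed
  qed
  define k where "k X = the_elem (h ` X)" for X
  have "k \<in> ring_iso (?S Quot J) (?R Quot I)"
    using h.FactRing_iso_set[OF surj] unfolding kernel k_def .
  then interpret affine_iso "?S Quot J" "?R Quot I" k by unfold_locales
  show ?thesis
    unfolding Spec_quotient_def
  proof (rule Spec_isomorphic_over)
    fix c :: 'k
    have c: "Poly_Mapping.single 0 c \<in> carrier ?S" by (rule const_param_ring)
    then show "J +>\<^bsub>?S\<^esub> Poly_Mapping.single 0 c \<in> carrier (?S Quot J)"
      by (auto simp: FactRing_def A_RCOSETS_def')
    show "k (J +>\<^bsub>?S\<^esub> Poly_Mapping.single 0 c) = I +>\<^bsub>?R\<^esub> Poly_Mapping.single 0 c"
      using h.the_elem_simp[OF c] unfolding kernel k_def by (simp add: h_def)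
  qed
qed

theorem corollary3p9:
  fixes \<O> :: "'x::{finite,linorder} pterm set"
    and \<tau>s :: "'x pterm list"
  assumes "finite \<O>" and "order_ideal \<O>" and "border_enumeration \<O> \<tau>s"
  shows "isomorphic_over
           (border_marked_scheme \<O> \<tau>s :: ('x, 'k::field) marked_scheme)
           (pommaret_marked_scheme \<O> :: ('x, 'k) marked_scheme)"
proof -
  interpret finite_order_ideal \<O> using assms(1,2) by unfold_locales
  interpret B: head_decomposition \<O> "border \<O>" "border_mult \<tau>s" tdeg
    using assms(3) by (rule border_head_decomposition)
  interpret P: head_decomposition \<O> "pommaret_basis \<O>" pommaret_mult "lex_weight bound"
    by (rule pommaret_head_decomposition)
  define V where "V = border \<O> \<times> \<O>"
  define W where "W = pommaret_basis \<O> \<times> \<O>"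
  have VW: "W \<subseteq> V" using pommaret_sub_border by (auto simp: V_def W_def)
  have ring: "border_ring \<O> = (param_ring V :: ('x, 'k) param_poly ring)"
    "pommaret_ring \<O> = (param_ring W :: ('x, 'k) param_poly ring)"
    using pommaret_sub_border
    by (auto simp: border_ring_def pommaret_ring_def V_def W_def intro!: arg_cong[of _ _ param_ring])
  let ?A = "carrier (param_ring V :: ('x, 'k) param_poly ring)"
  let ?A' = "carrier (param_ring W :: ('x, 'k) param_poly ring)"
  \<comment> \<open>The parameters that the Pommaret ring omits are those of the border terms outside the
    Pommaret basis, so it is the parameter ring of \<open>W\<close>.\<close>
  have sub: "?A' \<subseteq> ?A" using VW by (auto simp: param_ring_def)
  have paramV: "param \<alpha> \<sigma> \<in> ?A" if "\<alpha> \<in> border \<O>" "\<sigma> \<in> \<O>" for \<alpha> \<sigma>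
    unfolding param_eq_pvar using that by (intro var_param_ring) (simp add: V_def)
  have paramW: "param \<alpha> \<sigma> \<in> ?A'" if "\<alpha> \<in> pommaret_basis \<O>" "\<sigma> \<in> \<O>" for \<alpha> \<sigma>
    unfolding param_eq_pvar using that by (intro var_param_ring) (simp add: W_def)
  define N :: "'x pterm \<Rightarrow> 'x pterm \<Rightarrow> ('x, 'k) param_poly" where "N = P.normal_form param"
  \<comment> \<open>The substitution that is inverse to the inclusion modulo the two ideals.\<close>
  define e :: "'x pterm \<times> 'x pterm \<Rightarrow> ('x, 'k) param_poly" where "e = (\<lambda>(\<tau>, \<sigma>). N \<tau> \<sigma>)"
  have N_closed: "N t \<rho> \<in> ?A'" for t \<rho>
    unfolding N_def using subring_param_ring paramW by (rule P.normal_form_closed)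
  have e_closed: "e v \<in> ?A'" for v
    by (cases v) (simp add: e_def N_closed)
  define GB :: "('x, 'k) param_poly set" where
    "GB = {Poly_Mapping.lookup (reduced_form \<O> (border \<O>) (border_mult \<tau>s) (s_poly \<O> \<alpha> \<beta>)) t
       | \<alpha> \<beta> t. \<alpha> \<in> border \<O> \<and> \<beta> \<in> border \<O> \<and> neighbour_couple \<alpha> \<beta>}"
  define GP :: "('x, 'k) param_poly set" where
    "GP = {Poly_Mapping.lookup (reduced_form \<O> (pommaret_basis \<O>) pommaret_mult (s_poly \<O> \<alpha> \<beta>)) t
       | \<alpha> \<beta> t. \<alpha> \<in> pommaret_basis \<O> \<and> \<beta> \<in> pommaret_basis \<O> \<and> nonmultiplicative_couple \<alpha> \<beta>}"
  define I where "I = Idl\<^bsub>param_ring V\<^esub> GB"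
  define J where "J = Idl\<^bsub>param_ring W\<^esub> GP"
  have GB_closed: "GB \<subseteq> ?A"
    unfolding GB_def using B.reduced_s_poly_closed[OF subring_param_ring paramV] by blast
  have GP_closed: "GP \<subseteq> ?A'"
    unfolding GP_def using P.reduced_s_poly_closed[OF subring_param_ring paramW] by blast
  have I: "ideal I (param_ring V)" and GI: "GB \<subseteq> I"
    unfolding I_def using GB_closed by (rule genideal_param_ideal, rule genideal_param_self)
  have J: "ideal J (param_ring W)" and GJ: "GP \<subseteq> J"
    unfolding J_def using GP_closed by (rule genideal_param_ideal, rule genideal_param_self)
  interpret I: congruence ?A I using I by (rule congruence_ideal)
  interpret J: congruence ?A' J using J by (rule congruence_ideal)
  interpret C: commuting_var_mults \<O> ?A I "param :: 'x pterm \<Rightarrow> 'x pterm \<Rightarrow> ('x, 'k) param_poly"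
  proof
    show "param \<alpha> \<sigma> \<in> ?A" if "\<alpha> \<in> border \<O>" "\<sigma> \<in> \<O>" for \<alpha> \<sigma>
      using that by (rule paramV)
    show "I.eqv (var_mult param i (border_coord param (tvar j + \<sigma>)) \<rho>)
        (var_mult param j (border_coord param (tvar i + \<sigma>)) \<rho>)" if "\<sigma> \<in> \<O>" "\<rho> \<in> \<O>" for \<sigma> \<rho> i j
      unfolding I.eqv_def using assms(3) I.congruence_axioms _ that
      by (rule neighbours_commute) (use GI in \<open>auto simp: GB_def\<close>)
  qed
  have JI: "J \<subseteq> I"
  proof -
    have "GP \<subseteq> I"
      unfolding GP_def
      using reduced_s_poly_vanishes[OF C.commuting_var_mults_axioms pommaret_head_decomposition
          pommaret_sub_border]
      by blast
    \<comment> \<open>\<open>J\<close> is generated in the smaller ring, so it is compared with the trace of \<open>I\<close> there.\<close>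
    moreover have "ideal {f \<in> ?A'. f \<in> I} (param_ring W)"
      using sub by (intro ideal_preimage_param[OF I]) auto
    ultimately have "J \<subseteq> {f \<in> ?A'. f \<in> I}"
      unfolding J_def using GP_closed by (intro genideal_param_least) auto
    then show ?thesis by blast
  qed
  have multiple: "N (\<epsilon> + t) \<rho> - (\<Sum>\<sigma>\<in>\<O>. N t \<sigma> * N (\<epsilon> + \<sigma>) \<rho>) \<in> J" if "\<rho> \<in> \<O>" for \<epsilon> t \<rho>
    unfolding N_def using J.congruence_axioms paramW _ that
    by (rule pommaret_normal_form_multiple) (use GJ in \<open>auto simp: GP_def\<close>)
  have e_I: "substitute e f \<in> J" if "f \<in> I" for f
  proof -
    have "ideal {f \<in> ?A. substitute e f \<in> J} (param_ring V)"
      using e_closed by (intro ideal_preimage_param[OF J])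
        (auto intro: substitute_closed simp: substitute_add substitute_mult)
    moreover have "substitute e g \<in> J" if gB: "g \<in> GB" for g
    proof -
      obtain \<alpha> \<beta> \<rho> where
        g: "g = Poly_Mapping.lookup (reduced_form \<O> (border \<O>) (border_mult \<tau>s) (s_poly \<O> \<alpha> \<beta>)) \<rho>"
        using gB by (auto simp: GB_def)
      show ?thesis
        unfolding g e_def using J.congruence_axioms N_closed _ multiple
        by (rule B.substitute_reduced_s_poly) (simp_all add: N_def P.normal_form_O)
    qed
    then have "GB \<subseteq> {f \<in> ?A. substitute e f \<in> J}" using GB_closed by blast
    ultimately have "I \<subseteq> {f \<in> ?A. substitute e f \<in> J}"
      unfolding I_def by (rule genideal_param_least)
    then show ?thesis using that by blast
  qed
  have "isomorphic_over (Spec_quotient (param_ring V) I) (Spec_quotient (param_ring W) J)"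
  proof (rule param_quotient_schemes_isomorphic[OF VW I J JI e_closed _ _ e_I])
    fix v assume "v \<in> W"
    then obtain \<tau> \<rho> where v: "v = (\<tau>, \<rho>)" "\<tau> \<in> pommaret_basis \<O>" "\<rho> \<in> \<O>" by (auto simp: W_def)
    then show "e v = pvar v" by (simp add: e_def N_def P.normal_form_head param_eq_pvar)
  next
    fix v assume "v \<in> V"
    then obtain \<tau> \<rho> where v: "v = (\<tau>, \<rho>)" "\<tau> \<in> border \<O>" "\<rho> \<in> \<O>" by (auto simp: V_def)
    have "I.eqv (N \<tau> \<rho>) (power_coord param \<tau> \<rho>)"
      unfolding N_def using pommaret_head_decomposition pommaret_sub_border v(3)
      by (rule C.normal_form_power_coord)
    also have "I.eqv (power_coord param \<tau> \<rho>) (param \<tau> \<rho>)"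
      using v(2,3) by (rule C.power_coord_border)
    finally show "e v - pvar v \<in> I" by (simp add: v e_def I.eqv_def param_eq_pvar)
  qed
  moreover have "border_scheme_ideal \<O> \<tau>s = I" "pommaret_scheme_ideal \<O> = J"
    unfolding border_scheme_ideal_def pommaret_scheme_ideal_def ring I_def J_def GB_def GP_def
    by (rule refl)+
  ultimately show ?thesis
    by (simp add: border_marked_scheme_def pommaret_marked_scheme_def ring)
qed

end
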